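(* The spaces $(\pi'_l,{\cal U}^+)$, $(\pi'_l,{\cal U}^-)$, $(\pi'_r,{\cal U}'^+)$ and $(\pi'_r,{\cal U}'^-)$ do not have $\mathfrak u(2,2)$-invariant unitary structures.
   Context: $\mathbb H_{\mathbb C}=\mathbb C\otimes_{\mathbb R}\mathbb H$ is identified with $2\times2$ complex matrices $Z=z^0e_0+z^1e_1+z^2e_2+z^3e_3$, $z^j\in\mathbb C$, with $e_0=1$, $e_1=\bigl(\begin{smallmatrix}0&-i\\-i&0\end{smallmatrix}\bigr)$, $e_2=\bigl(\begin{smallmatrix}0&-1\\1&0\end{smallmatrix}\bigr)$, $e_3=\bigl(\begin{smallmatrix}-i&0\\0&i\end{smallmatrix}\bigr)$; $N(Z)=\det Z$. $\mathbb S$, $\mathbb S'$ are the spaces of complex $2$-columns and $2$-rows. $\nabla=e_0\partial_{z^0}-e_1\partial_{z^1}-e_2\partial_{z^2}-e_3\partial_{z^3}$, $\square=\sum_j\partial_{z^j}^2$, $g\overleftarrow\nabla$ is $\nabla$ acting from the right. ${\cal U}=\{f\in\mathbb C[z^0,z^1,z^2,z^3,N(Z)^{-1}]\otimes\mathbb S;\nabla\square f=0\}$, ${\cal U}'=\{g\in\mathbb C[z^0,z^1,z^2,z^3,N(Z)^{-1}]\otimes\mathbb S';(\square g)\overleftarrow\nabla=0\}$; ${\cal U}^+$, ${\cal U}'^+$ (resp. ${\cal U}^-$, ${\cal U}'^-$) are the spans of the homogeneous elements of degree $\ge0$ (resp. $<0$). $\mathfrak{gl}(2,\mathbb H_{\mathbb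 C})\simeq\mathfrak{gl}(4,\mathbb C)$ acts by differentiating $(\pi'_l(h)f)(Z)=\frac{a'-Zc'}{N(a'-Zc')}f\bigl((a'-Zc')^{-1}(-b'+Zd')\bigr)$, $(\pi'_r(h)g)(Z)=g\bigl((aZ+b)(cZ+d)^{-1}\bigr)\frac{cZ+d}{N(cZ+d)}$, $h=\bigl(\begin{smallmatrix}a'&b'\\ c'&d'\end{smallmatrix}\bigr)$, $h^{-1}=\bigl(\begin{smallmatrix}a&b\\ c&d\end{smallmatrix}\bigr)$. $\mathfrak u(2,2)=\bigl\{\bigl(\begin{smallmatrix}A&B\\ B^*&D\end{smallmatrix}\bigr);A,B,D\in\mathbb H_{\mathbb C},A=-A^*,D=-D^*\bigr\}$. A $\mathfrak u(2,2)$-invariant unitary structure on a representation $\pi$ is a positive definite Hermitian inner product with $(\pi(Y)u,v)+(u,\pi(Y)v)=0$ for all $Y\in\mathfrak u(2,2)$. *)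

theory Defs
  imports "HOL-Analysis.Analysis" "HOL-Library.Function_Algebras"
begin

section \<open>Complexified quaternions\<close>

type_synonym HC = "complex^2^2"

definition mscale :: "complex \<Rightarrow> HC \<Rightarrow> HC"
  where "mscale c A = (\<chi> i j. c * A $ i $ j)"

definition e0 :: HC where "e0 = mat 1"
definition e1 :: HC where "e1 = vector [vector [0, - \<i>], vector [- \<i>, 0]]"
definition e2 :: HC where "e2 = vector [vector [0, - 1], vector [1, 0]]"
definition e3 :: HC where "e3 = vector [vector [- \<i>, 0], vector [0, \<i>]]"

definition z0 :: "HC \<Rightarrow> complex" where "z0 Z = (Z$1$1 + Z$2$2) / 2"
definition z1 :: "HC \<Rightarrow> complex" where "z1 Z = \<i> * (Z$1$2 + Z$2$1) / 2"
definition z2 :: "HC \<Rightarrow> complex" where "z2 Z = (Z$2$1 - Z$1$2) / 2"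
definition z3 :: "HC \<Rightarrow> complex" where "z3 Z = \<i> * (Z$1$1 - Z$2$2) / 2"

lemma coordinates:
  "Z = mscale c0 e0 + mscale c1 e1 + mscale c2 e2 + mscale c3 e3 \<longleftrightarrow>
   c0 = z0 Z \<and> c1 = z1 Z \<and> c2 = z2 Z \<and> c3 = z3 Z"
  by (auto simp: vec_eq_iff forall_2 mscale_def e0_def e1_def e2_def e3_def mat_def
      z0_def z1_def z2_def z3_def vector_2 field_simps complex_eq_iff)

abbreviation N :: "HC \<Rightarrow> complex" where "N \<equiv> det"

definition ctranspose :: "HC \<Rightarrow> HC"
  where "ctranspose A = (\<chi> i j. cnj (A $ j $ i))"


section \<open>Spinor-valued functions\<close>

text \<open>
  Columns and rows both have type \<^typ>\<open>complex^2\<close>; matrices act on columns by \<open>*v\<close> and on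
  rows by \<open>v*\<close>.

  Elements of the localized polynomial ring are represented as functions on the set
  where \<open>N Z \<noteq> 0\<close>, extended by zero so that equality of functions is equality of elements.
\<close>

type_synonym spinor_fun = "HC \<Rightarrow> complex^2"

definition on_units :: "(HC \<Rightarrow> 'a) \<Rightarrow> HC \<Rightarrow> 'a::zero"
  where "on_units f = (\<lambda>Z. if N Z \<noteq> 0 then f Z else 0)"

inductive_set localized_poly :: "(HC \<Rightarrow> complex) set" where
  const: "on_units (\<lambda>Z. c) \<in> localized_poly"
| coord0: "on_units z0 \<in> localized_poly"
| coord1: "on_units z1 \<in> localized_poly"
| coord2: "on_units z2 \<in> localized_poly"
| coord3: "on_units z3 \<in> localized_poly"
| inverse_N: "on_units (\<lambda>Z. inverse (N Z)) \<in> localized_poly"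
| add: "f \<in> localized_poly \<Longrightarrow> g \<in> localized_poly \<Longrightarrow> (\<lambda>Z. f Z + g Z) \<in> localized_poly"
| mult: "f \<in> localized_poly \<Longrightarrow> g \<in> localized_poly \<Longrightarrow> (\<lambda>Z. f Z * g Z) \<in> localized_poly"

definition spinor_poly :: "spinor_fun set"
  where "spinor_poly = {f. \<forall>k. (\<lambda>Z. f Z $ k) \<in> localized_poly}"

definition fscale :: "complex \<Rightarrow> spinor_fun \<Rightarrow> spinor_fun"
  where "fscale c f = (\<lambda>Z. c *s f Z)"

global_interpretation spinor_fun: vector_space fscale
  by unfold_locales (auto simp: fscale_def fun_eq_iff vec_eq_iff algebra_simps)


section \<open>Differential operators\<close>

text \<open>Since \<open>e\<^sub>j\<close> is the coordinate direction of \<open>z\<^sup>j\<close>, \<open>partial e\<^sub>j\<close> is the complex partial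
  derivative with respect to \<open>z\<^sup>j\<close>.\<close>

definition partial :: "HC \<Rightarrow> spinor_fun \<Rightarrow> spinor_fun"
  where "partial E f = (\<lambda>Z. \<chi> k. deriv (\<lambda>t. f (Z + mscale t E) $ k) 0)"

definition box :: "spinor_fun \<Rightarrow> spinor_fun"
  where "box f = (\<lambda>Z. partial e0 (partial e0 f) Z + partial e1 (partial e1 f) Z
                    + partial e2 (partial e2 f) Z + partial e3 (partial e3 f) Z)"

definition nabla_l :: "spinor_fun \<Rightarrow> spinor_fun"
  where "nabla_l f = (\<lambda>Z. e0 *v partial e0 f Z - e1 *v partial e1 f Z
                        - e2 *v partial e2 f Z - e3 *v partial e3 f Z)"

definition nabla_r :: "spinor_fun \<Rightarrow> spinor_fun"
  where "nabla_r g = (\<lambda>Z. partial e0 g Z v* e0 - partial e1 g Z v* e1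
                        - partial e2 g Z v* e2 - partial e3 g Z v* e3)"


section \<open>The function spaces\<close>

definition U_l :: "spinor_fun set"
  where "U_l = {f \<in> spinor_poly. \<forall>Z. N Z \<noteq> 0 \<longrightarrow> nabla_l (box f) Z = 0}"

definition U_r :: "spinor_fun set"
  where "U_r = {g \<in> spinor_poly. \<forall>Z. N Z \<noteq> 0 \<longrightarrow> nabla_r (box g) Z = 0}"

definition homogeneous :: "int \<Rightarrow> spinor_fun \<Rightarrow> bool"
  where "homogeneous d f \<longleftrightarrow>
    (\<forall>c Z. c \<noteq> 0 \<longrightarrow> N Z \<noteq> 0 \<longrightarrow> f (mscale c Z) = (c powi d) *s f Z)"

definition U_l_plus :: "spinor_fun set"
  where "U_l_plus = spinor_fun.span {f \<in> U_l. \<exists>d\<ge>0. homogeneous d f}"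

definition U_l_minus :: "spinor_fun set"
  where "U_l_minus = spinor_fun.span {f \<in> U_l. \<exists>d<0. homogeneous d f}"

definition U_r_plus :: "spinor_fun set"
  where "U_r_plus = spinor_fun.span {g \<in> U_r. \<exists>d\<ge>0. homogeneous d g}"

definition U_r_minus :: "spinor_fun set"
  where "U_r_minus = spinor_fun.span {g \<in> U_r. \<exists>d<0. homogeneous d g}"


section \<open>Group and Lie algebra actions\<close>

text \<open>The index type \<^typ>\<open>2 + 2\<close> makes the \<open>2 \<times> 2\<close> block structure of \<open>gl(2, HC)\<close> visible.\<close>

type_synonym gl2HC = "complex^(2 + 2)^(2 + 2)"

definition block11 :: "gl2HC \<Rightarrow> HC" where "block11 h = (\<chi> i j. h $ Inl i $ Inl j)"
definition block12 :: "gl2HC \<Rightarrow> HC" where "block12 h = (\<chi> i j. h $ Inl i $ Inr j)"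
definition block21 :: "gl2HC \<Rightarrow> HC" where "block21 h = (\<chi> i j. h $ Inr i $ Inl j)"
definition block22 :: "gl2HC \<Rightarrow> HC" where "block22 h = (\<chi> i j. h $ Inr i $ Inr j)"

definition pi_l :: "gl2HC \<Rightarrow> spinor_fun \<Rightarrow> spinor_fun"
  where "pi_l h f = (\<lambda>Z.
    let a' = block11 h; b' = block12 h; c' = block21 h; d' = block22 h; w = a' - Z ** c'
    in inverse (N w) *s (w *v f (matrix_inv w ** (- b' + Z ** d'))))"

definition pi_r :: "gl2HC \<Rightarrow> spinor_fun \<Rightarrow> spinor_fun"
  where "pi_r h g = (\<lambda>Z.
    let k = matrix_inv h; a = block11 k; b = block12 k; c = block21 k; d = block22 k;
        w = c ** Z + d
    in inverse (N w) *s (g ((a ** Z + b) ** matrix_inv w) v* w))"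

text \<open>Pointwise differential at the identity, in the direction \<open>Y\<close>, of \<open>h \<mapsto> \<pi> h f\<close>.\<close>

definition lie_action ::
  "(gl2HC \<Rightarrow> spinor_fun \<Rightarrow> spinor_fun) \<Rightarrow> gl2HC \<Rightarrow> spinor_fun \<Rightarrow> spinor_fun"
  where "lie_action \<pi> Y f =
    on_units (\<lambda>Z. frechet_derivative (\<lambda>h. \<pi> h f Z) (at (mat 1)) Y)"

definition u22 :: "gl2HC set"
  where "u22 = {Y. block11 Y = - ctranspose (block11 Y) \<and>
                   block22 Y = - ctranspose (block22 Y) \<and>
                   block21 Y = ctranspose (block12 Y)}"


section \<open>Unitary structures\<close>

definition hermitian_inner_product_on ::
  "spinor_fun set \<Rightarrow> (spinor_fun \<Rightarrow> spinor_fun \<Rightarrow> complex) \<Rightarrow> bool"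
  where "hermitian_inner_product_on V B \<longleftrightarrow>
    (\<forall>u\<in>V. \<forall>v\<in>V. \<forall>w\<in>V. B (u + v) w = B u w + B v w) \<and>
    (\<forall>c. \<forall>u\<in>V. \<forall>v\<in>V. B (fscale c u) v = c * B u v) \<and>
    (\<forall>u\<in>V. \<forall>v\<in>V. B v u = cnj (B u v)) \<and>
    (\<forall>u\<in>V. u \<noteq> 0 \<longrightarrow> B u u \<in> \<real> \<and> Re (B u u) > 0)"

definition u22_invariant_unitary_structure ::
  "(gl2HC \<Rightarrow> spinor_fun \<Rightarrow> spinor_fun) \<Rightarrow> spinor_fun set \<Rightarrow>
   (spinor_fun \<Rightarrow> spinor_fun \<Rightarrow> complex) \<Rightarrow> bool"
  where "u22_invariant_unitary_structure \<rho> V B \<longleftrightarrow>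
    hermitian_inner_product_on V B \<and>
    (\<forall>Y\<in>u22. \<forall>u\<in>V. \<forall>v\<in>V. B (\<rho> Y u) v + B u (\<rho> Y v) = 0)"

end

theory Submission
  imports Defs
begin

text \<open>
  Differentiating \<open>\<pi>'\<^sub>l\<close> along an off-diagonal matrix with blocks \<open>B\<close> and \<open>C\<close> gives \<open>P\<^sub>B + K\<^sub>C\<close>, where
  \<open>P\<^sub>B f = - D\<^sub>B f\<close> comes from translations and
  \<open>K\<^sub>C f = tr (Z C) f - Z C f + D\<^sub>Z\<^sub>C\<^sub>Z f\<close> from inverted translations
  (\<open>lie_action_noncompact\<close>). The matrix lies in \<open>u(2,2)\<close> when \<open>C = B\<^sup>*\<close>, and replacing \<open>B\<close> by
  \<open>\<i> B\<close> shows that in a unitary structure \<open>P\<^sub>B\<close> and \<open>- K\<^sub>C\<close> with \<open>C = B\<^sup>*\<close> are adjoint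
  (\<open>translation_adjoint\<close>).

  In both spaces this forces a negative square length. In degree \<open>\<ge> 0\<close> take the basis \<open>u\<close>, \<open>v\<close>
  of constant spinors and \<open>f = Z v\<close>, the second column of \<open>Z\<close>: for suitable \<open>B\<close>, \<open>B'\<close> the translations
  send \<open>f\<close> to \<open>u\<close> and to \<open>v\<close>, while \<open>f\<close> is the sum of the images of \<open>u\<close> and \<open>v\<close> under the matching
  inverted translations. Then \<open>(f, f) = - (u, u) - (v, v)\<close> (\<open>not_unitary_raising\<close>). In degree
  \<open>< 0\<close> the same happens with the roles of \<open>P\<close> and \<open>K\<close> exchanged, for \<open>f = e / N(Z)\<close> with a
  constant spinor \<open>e\<close> and for the two columns of \<open>Z / N(Z)\<close> (\<open>not_unitary_lowering\<close>).

  The map \<open>f \<mapsto> f(Z\<^sup>T)\<close> intertwines the left action with the right one, up to an automorphism of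
  the group that preserves \<open>u(2,2)\<close>, and carries the left spaces into the right ones; so a unitary
  structure on the right would give one on the left (\<open>unitary_structure_transposed\<close>).

  To compute with these operators, directional derivatives are treated as commuting derivations
  \<open>D E\<close> of the ring of localized polynomials that are linear in \<open>E\<close>; identities between explicit
  spinors then reduce to polynomial identities in the entries of \<open>Z\<close> and \<open>1 / N(Z)\<close>.
\<close>

section \<open>The differential of matrix inversion at the identity\<close>

lemma bounded_bilinear_matrix_mul:
  "bounded_bilinear ((**) :: complex^'n^'m \<Rightarrow> complex^'p^'n \<Rightarrow> complex^'p^'m)"
  unfolding bilinear_conv_bounded_bilinear[symmetric] bilinear_def
  by (intro conjI allI linearI)
    (simp_all add: vec_eq_iff matrix_matrix_mult_def sum.distrib algebra_simps scaleR_sum_right)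

lemmas has_derivative_matrix_mul [derivative_intros] =
  bounded_bilinear.FDERIV[OF bounded_bilinear_matrix_mul]

lemma eventually_invertible_at_mat_1:
  "\<forall>\<^sub>F h in nhds (mat 1 :: complex^'n^'n). invertible h"
proof -
  have "isCont (det :: complex^'n^'n \<Rightarrow> complex) (mat 1)"
    unfolding det_def by (intro continuous_intros)
  then have "(det \<longlongrightarrow> (1::complex)) (at (mat 1 :: complex^'n^'n))"
    unfolding isCont_def by simp
  then have "\<forall>\<^sub>F h in at (mat 1 :: complex^'n^'n). det h \<noteq> 0"
    by (rule tendsto_imp_eventually_ne) simp
  then have "\<forall>\<^sub>F h in nhds (mat 1 :: complex^'n^'n). det h \<noteq> 0"
    unfolding eventually_at_filter by (rule eventually_mono) (metis UNIV_I det_I zero_neq_one)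
  then show ?thesis by (simp add: invertible_det_nz)
qed

lemma matrix_inv_left:
  fixes A :: "complex^'n^'n"
  assumes "invertible A"
  shows "matrix_inv A ** A = mat 1"
  using assms unfolding invertible_def matrix_inv_def by (rule someI2_ex) blast

lemma matrix_inv_eqI:
  fixes A :: "complex^'n^'n"
  assumes "A ** B = mat 1"
  shows "matrix_inv A = B"
proof -
  have "B ** A = mat 1" using assms matrix_left_right_inverse by blast
  then have "invertible A" using assms invertible_def by blast
  then have "matrix_inv A ** A = mat 1" by (rule matrix_inv_left)
  then have "matrix_inv A ** (A ** B) = B" by (simp add: matrix_mul_assoc)
  then show ?thesis using assms by simp
qed

text \<open>If \<open>h = 1 + E\<close> has inverse \<open>X\<close>, then \<open>X - 1 + E = X E E\<close>, and \<open>X\<close> stays bounded because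
  \<open>X = 1 - X E\<close>; so the error of the linear approximation \<open>1 - E\<close> is quadratic in \<open>E\<close>.\<close>

lemma has_derivative_matrix_inv_1:
  "((matrix_inv :: complex^'n^'n \<Rightarrow> complex^'n^'n) has_derivative uminus) (at (mat 1))"
  unfolding has_derivative_at_alt
proof (intro conjI allI impI)
  show "bounded_linear (uminus :: complex^'n^'n \<Rightarrow> complex^'n^'n)"
    by (simp add: bounded_linear_minus)
  fix e :: real assume "e > 0"
  obtain K where K: "K > 0"
    "\<And>(A :: complex^'n^'n) (B :: complex^'n^'n). norm (A ** B) \<le> norm A * norm B * K"
    using bounded_bilinear.pos_bounded[OF bounded_bilinear_matrix_mul] by blast
  obtain r where r: "r > 0" "\<And>h :: complex^'n^'n. dist h (mat 1) < r \<Longrightarrow> invertible h"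
    using eventually_invertible_at_mat_1 by (auto simp: eventually_nhds_metric)
  define n1 where "n1 = norm (mat 1 :: complex^'n^'n)"
  have "n1 \<ge> 0" by (simp add: n1_def)
  \<comment> \<open>The second bound keeps \<open>norm X \<le> 2 * n1\<close>, the third absorbs the resulting constant
    of the quadratic error.\<close>
  define d where "d = min r (min (1 / (2 * K)) (e / (2 * n1 * K * K + 1)))"
  have den: "2 * n1 * K * K + 1 > 0" using K(1) \<open>n1 \<ge> 0\<close> by (smt (verit) mult_nonneg_nonneg)
  have "d > 0" using r(1) K(1) \<open>e > 0\<close> den by (simp add: d_def)
  moreover have "norm (matrix_inv h - matrix_inv (mat 1) - - (h - mat 1)) \<le> e * norm (h - mat 1)"
    if h: "norm (h - mat 1) < d" for h :: "complex^'n^'n"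
  proof -
    define E where "E = h - mat 1"
    define X where "X = matrix_inv h"
    have "invertible h" using h by (intro r(2)) (simp add: d_def dist_norm)
    then have "X ** h = mat 1" by (simp add: X_def matrix_inv_left)
    then have XE: "X ** E = mat 1 - X"
      by (simp add: E_def bounded_bilinear.diff_right[OF bounded_bilinear_matrix_mul])
    then have XEE: "X - mat 1 + E = (X ** E) ** E"
      by (simp add: bounded_bilinear.diff_left[OF bounded_bilinear_matrix_mul])
    have nE: "norm E < 1 / (2 * K)" "norm E < e / (2 * n1 * K * K + 1)"
      using h by (simp_all add: d_def E_def)
    have "norm X \<le> n1 + norm (X ** E)"
      using norm_triangle_ineq4[of "mat 1" "X ** E"] by (simp add: XE n1_def)
    also have "\<dots> \<le> n1 + norm X * (norm E * K)" using K(2)[of X E] by (simp add: mult.assoc)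
    also have "\<dots> \<le> n1 + norm X * (1/2)"
      using nE(1) K(1) by (intro add_left_mono mult_left_mono) (auto simp: field_simps)
    finally have X: "norm X \<le> 2 * n1" by simp
    have "norm (X - mat 1 + E) \<le> norm X * norm E * K * norm E * K"
      unfolding XEE using K by (meson order_trans mult_right_mono less_imp_le norm_ge_zero)
    also have "\<dots> = norm X * (norm E * K * norm E * K)" by simp
    also have "\<dots> \<le> 2 * n1 * (norm E * K * norm E * K)"
      using X K(1) by (intro mult_right_mono) auto
    also have "\<dots> = (norm E * (2 * n1 * K * K)) * norm E" by (simp add: algebra_simps)
    also have "\<dots> \<le> e * norm E"
    proof (rule mult_right_mono)
      have "norm E * (2 * n1 * K * K + 1) < e" using nE(2) den by (simp add: field_simps)
      then show "norm E * (2 * n1 * K * K) \<le> e"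
        using norm_ge_zero[of E] unfolding distrib_left using norm_ge_zero[of E] by linarith
    qed simp
    finally show ?thesis
      by (simp add: X_def E_def matrix_inv_eqI)
  qed
  ultimately show "\<exists>d>0. \<forall>y. norm (y - mat 1 :: complex^'n^'n) < d \<longrightarrow>
      norm (matrix_inv y - matrix_inv (mat 1) - - (y - mat 1)) \<le> e * norm (y - mat 1)"
    by blast
qed

section \<open>The localized polynomials as a differential ring\<close>

definition cst :: "complex \<Rightarrow> HC \<Rightarrow> complex"
  where "cst c = on_units (\<lambda>Z. c)"

definition entry :: "2 \<Rightarrow> 2 \<Rightarrow> HC \<Rightarrow> complex"
  where "entry i j = on_units (\<lambda>Z. Z $ i $ j)"

definition Ninv :: "HC \<Rightarrow> complex"
  where "Ninv = on_units (\<lambda>Z. inverse (N Z))"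

text \<open>The scalar counterpart of \<open>partial\<close>, cut off at singular matrices so that it maps localized
  polynomials to localized polynomials.\<close>

definition D :: "HC \<Rightarrow> (HC \<Rightarrow> complex) \<Rightarrow> HC \<Rightarrow> complex"
  where "D E \<phi> = on_units (\<lambda>Z. deriv (\<lambda>t. \<phi> (Z + mscale t E)) 0)"

lemma on_units_eval [simp]: "N Z \<noteq> 0 \<Longrightarrow> on_units f Z = f Z" "N Z = 0 \<Longrightarrow> on_units f Z = 0"
  by (simp_all add: on_units_def)

lemma cst_eval [simp]: "N Z \<noteq> 0 \<Longrightarrow> cst c Z = c"
  and entry_eval [simp]: "N Z \<noteq> 0 \<Longrightarrow> entry i j Z = Z $ i $ j"
  and Ninv_eval [simp]: "N Z \<noteq> 0 \<Longrightarrow> Ninv Z = inverse (N Z)"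
  by (simp_all add: cst_def entry_def Ninv_def)

lemma localized_poly_off_units: "\<phi> \<in> localized_poly \<Longrightarrow> N Z = 0 \<Longrightarrow> \<phi> Z = 0"
  by (induction rule: localized_poly.induct) auto

lemma localized_poly_eqI:
  assumes "\<phi> \<in> localized_poly" "\<psi> \<in> localized_poly" "\<And>Z. N Z \<noteq> 0 \<Longrightarrow> \<phi> Z = \<psi> Z"
  shows "\<phi> = \<psi>"
proof
  fix Z show "\<phi> Z = \<psi> Z"
    using assms by (cases "N Z = 0") (simp_all add: localized_poly_off_units)
qed

lemma cst_in [simp, intro]: "cst c \<in> localized_poly"
  and Ninv_in [simp, intro]: "Ninv \<in> localized_poly"
  by (simp_all add: cst_def Ninv_def localized_poly.intros)

lemma add_in [simp, intro]:
  "\<phi> \<in> localized_poly \<Longrightarrow> \<psi> \<in> localized_poly \<Longrightarrow> \<phi> + \<psi> \<in> localized_poly"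
  by (simp add: plus_fun_def localized_poly.add)

lemma mult_in [simp, intro]:
  "\<phi> \<in> localized_poly \<Longrightarrow> \<psi> \<in> localized_poly \<Longrightarrow> \<phi> * \<psi> \<in> localized_poly"
  by (simp add: times_fun_def localized_poly.mult)

lemma cst_0 [simp]: "cst 0 = 0"
  by (auto simp: cst_def on_units_def)

lemma zero_in [simp, intro]: "0 \<in> localized_poly"
  using cst_in[of 0] by simp

text \<open>Numerals are constant functions on all matrices, so they are not localized polynomials; in
  products they may be replaced by the constants that are.\<close>

lemma numeral_mult_localized [simp]:
  assumes "\<phi> \<in> localized_poly"
  shows "numeral k * \<phi> = cst (numeral k) * \<phi>"
  using localized_poly_off_units[OF assms] by (auto simp: fun_eq_iff cst_def on_units_def)

lemma uminus_in [simp, intro]: "\<phi> \<in> localized_poly \<Longrightarrow> - \<phi> \<in> localized_poly"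
proof -
  assume \<phi>: "\<phi> \<in> localized_poly"
  have "- \<phi> = cst (-1) * \<phi>"
    using localized_poly_off_units[OF \<phi>] by (auto simp: cst_def on_units_def)
  then show ?thesis using \<phi> by simp
qed

lemma minus_in [simp, intro]:
  "\<phi> \<in> localized_poly \<Longrightarrow> \<psi> \<in> localized_poly \<Longrightarrow> \<phi> - \<psi> \<in> localized_poly"
  using add_in[of \<phi> "- \<psi>"] by simp

lemma entry_in [simp, intro]: "entry i j \<in> localized_poly"
proof -
  note z = localized_poly.coord0 localized_poly.coord1 localized_poly.coord2 localized_poly.coord3
  have "entry 1 1 = on_units z0 + cst (- \<i>) * on_units z3"
    "entry 2 2 = on_units z0 + cst \<i> * on_units z3"
    "entry 1 2 = cst (-1) * on_units z2 + cst (- \<i>) * on_units z1"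
    "entry 2 1 = on_units z2 + cst (- \<i>) * on_units z1"
    by (auto simp: fun_eq_iff entry_def cst_def on_units_def z0_def z1_def z2_def z3_def field_simps)
  then have "entry 1 1 \<in> localized_poly" "entry 2 2 \<in> localized_poly"
    "entry 1 2 \<in> localized_poly" "entry 2 1 \<in> localized_poly"
    using z by simp_all
  then show ?thesis using exhaust_2[of i] exhaust_2[of j] by auto
qed

lemma eventually_unit:
  assumes "N (Z::HC) \<noteq> 0"
  shows "\<forall>\<^sub>F W in nhds Z. N W \<noteq> 0"
proof -
  have "isCont N Z" unfolding det_2 by (intro continuous_intros)
  then have "\<forall>\<^sub>F W in at Z. N W \<noteq> 0"
    using assms unfolding isCont_def by (rule tendsto_imp_eventually_ne)
  then show ?thesis
    unfolding eventually_at_filter by (rule eventually_mono) (use assms in auto)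
qed

lemma has_derivative_on_units:
  assumes "N Z \<noteq> 0"
  shows "(on_units \<phi> has_derivative L) (at Z) \<longleftrightarrow> (\<phi> has_derivative L) (at Z)"
proof -
  have "\<forall>\<^sub>F W in at Z. on_units \<phi> W = \<phi> W"
    unfolding eventually_at_filter using eventually_unit[OF assms] by (rule eventually_mono) simp
  moreover from this have "\<forall>\<^sub>F W in at Z. \<phi> W = on_units \<phi> W" by (rule eventually_mono) simp
  ultimately show ?thesis
    using assms by (auto intro: has_derivative_transform_eventually)
qed

lemmas has_derivative_entries [derivative_intros] =
  bounded_linear.has_derivative[OF bounded_linear_vec_nth]

lemma has_derivative_N:
  "(N has_derivative (\<lambda>E. E$1$1 * Z$2$2 + Z$1$1 * E$2$2 - E$1$2 * Z$2$1 - Z$1$2 * E$2$1)) (at (Z::HC))"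
  unfolding det_2 by (auto intro!: derivative_eq_intros simp: algebra_simps)

lemma localized_poly_differentiable:
  assumes "\<phi> \<in> localized_poly" "N Z \<noteq> 0"
  shows "\<exists>L. (\<phi> has_derivative L) (at Z) \<and> (\<forall>c E. L (mscale c E) = c * L E)"
  using assms
proof (induction rule: localized_poly.induct)
  case (const c)
  then show ?case
    by (intro exI[of _ "\<lambda>_. 0"]) (simp add: has_derivative_on_units)
next
  case coord0
  have "(z0 has_derivative z0) (at Z)"
    unfolding z0_def by (auto intro!: derivative_eq_intros)
  then show ?case using coord0
    by (intro exI[of _ z0] conjI) (simp_all add: has_derivative_on_units, simp add: z0_def mscale_def algebra_simps)
next
  case coord1
  have "(z1 has_derivative z1) (at Z)"
    unfolding z1_def by (auto intro!: derivative_eq_intros simp: field_simps)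
  then show ?case using coord1
    by (intro exI[of _ z1] conjI) (simp_all add: has_derivative_on_units, simp add: z1_def mscale_def algebra_simps)
next
  case coord2
  have "(z2 has_derivative z2) (at Z)"
    unfolding z2_def by (auto intro!: derivative_eq_intros)
  then show ?case using coord2
    by (intro exI[of _ z2] conjI) (simp_all add: has_derivative_on_units, simp add: z2_def mscale_def algebra_simps)
next
  case coord3
  have "(z3 has_derivative z3) (at Z)"
    unfolding z3_def by (auto intro!: derivative_eq_intros simp: field_simps)
  then show ?case using coord3
    by (intro exI[of _ z3] conjI) (simp_all add: has_derivative_on_units, simp add: z3_def mscale_def algebra_simps)
next
  case inverse_N
  have "((\<lambda>Z. inverse (N Z)) has_derivative (\<lambda>E. - (inverse (N Z) * (E$1$1 * Z$2$2 + Z$1$1 * E$2$2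
      - E$1$2 * Z$2$1 - Z$1$2 * E$2$1) * inverse (N Z)))) (at Z)"
    using inverse_N by (intro Deriv.has_derivative_inverse has_derivative_N)
  then have "(on_units (\<lambda>Z. inverse (N Z)) has_derivative (\<lambda>E. - (inverse (N Z) * (E$1$1 * Z$2$2 +
      Z$1$1 * E$2$2 - E$1$2 * Z$2$1 - Z$1$2 * E$2$1) * inverse (N Z)))) (at Z)"
    by (rule has_derivative_on_units[OF inverse_N, THEN iffD2])
  then show ?case by (intro exI conjI, assumption) (simp add: mscale_def algebra_simps)
next
  case (add f g)
  then obtain F G where
    "(f has_derivative F) (at Z)" "\<forall>c E. F (mscale c E) = c * F E"
    "(g has_derivative G) (at Z)" "\<forall>c E. G (mscale c E) = c * G E" by blast
  then show ?case
    by (intro exI[of _ "\<lambda>E. F E + G E"]) (auto intro!: derivative_eq_intros simp: algebra_simps)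
next
  case (mult f g)
  then obtain F G where
    "(f has_derivative F) (at Z)" "\<forall>c E. F (mscale c E) = c * F E"
    "(g has_derivative G) (at Z)" "\<forall>c E. G (mscale c E) = c * G E" by blast
  then show ?case
    by (intro exI[of _ "\<lambda>E. f Z * G E + F E * g Z"])
      (auto intro!: derivative_eq_intros simp: algebra_simps)
qed

lemma mscale_nth [simp]: "mscale c Z $ i $ j = c * Z $ i $ j"
  by (simp add: mscale_def)

lemma bounded_linear_mscale: "bounded_linear (\<lambda>t. mscale t E)"
proof -
  have "linear (\<lambda>t. mscale t E)"
    by (intro linearI) (simp_all add: vec_eq_iff mscale_def algebra_simps)
  then show ?thesis using linear_conv_bounded_linear by blast
qed

lemma line_derivative:
  assumes "(\<phi> has_derivative L) (at Z)" "\<And>c E. L (mscale c E) = c * L E"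
  shows "((\<lambda>t. \<phi> (Z + mscale t E)) has_field_derivative L E) (at 0)"
proof -
  have 1: "((\<lambda>t. Z + mscale t E) has_derivative (\<lambda>t. mscale t E)) (at 0)"
    by (auto intro!: derivative_eq_intros bounded_linear.has_derivative[OF bounded_linear_mscale])
  have 2: "Z + mscale 0 E = Z" by (simp add: vec_eq_iff mscale_def)
  have "((\<lambda>t. \<phi> (Z + mscale t E)) has_derivative (\<lambda>t. L (mscale t E))) (at 0)"
    using has_derivative_compose[OF 1, of \<phi> L] assms(1) 2 by simp
  then show ?thesis
    using assms(2) by (simp add: has_field_derivative_def mult.commute[of _ "L E"])
qed

text \<open>The group actions are differentiated in the real sense, the operators \<open>\<nabla>\<close> and \<open>\<box>\<close> along complex
  lines. For localized polynomials both are governed by one complex linear map.\<close>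

lemma has_derivative_D:
  assumes "\<phi> \<in> localized_poly" "N Z \<noteq> 0"
  shows "(\<phi> has_derivative (\<lambda>E. D E \<phi> Z)) (at Z)"
    and "D (mscale c E) \<phi> Z = c * D E \<phi> Z"
    and "((\<lambda>t. \<phi> (Z + mscale t E)) has_field_derivative D E \<phi> Z) (at 0)"
proof -
  obtain L where L: "(\<phi> has_derivative L) (at Z)" "\<And>c E. L (mscale c E) = c * L E"
    using localized_poly_differentiable[OF assms] by blast
  have D: "D E \<phi> Z = L E" for E
    using line_derivative[OF L] assms(2) by (simp add: D_def DERIV_imp_deriv)
  show "(\<phi> has_derivative (\<lambda>E. D E \<phi> Z)) (at Z)"
    "D (mscale c E) \<phi> Z = c * D E \<phi> Z"
    "((\<lambda>t. \<phi> (Z + mscale t E)) has_field_derivative D E \<phi> Z) (at 0)"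
    using L line_derivative[OF L] by (simp_all add: D)
qed

lemma D_off_units [simp]: "N Z = 0 \<Longrightarrow> D E \<phi> Z = 0"
  by (simp add: D_def)

lemma D_eqI:
  assumes "\<phi> \<in> localized_poly" "N Z \<noteq> 0" "(\<phi> has_derivative L) (at Z)"
  shows "D E \<phi> Z = L E"
  using has_derivative_unique[OF has_derivative_D(1)[OF assms(1,2)] assms(3)] by (simp add: fun_eq_iff)

lemma D_cst [simp]: "D E (cst c) = 0"
proof
  fix Z show "D E (cst c) Z = 0 Z"
  proof (cases "N Z = 0")
    case False
    then have "(cst c has_derivative (\<lambda>_. 0)) (at Z)"
      by (simp add: cst_def has_derivative_on_units)
    from D_eqI[OF cst_in False this] show ?thesis by simp
  qed simp
qed

lemma D_zero [simp]: "D E 0 = 0"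
  using D_cst[of E 0] by simp

lemma D_add [simp]:
  assumes "\<phi> \<in> localized_poly" "\<psi> \<in> localized_poly"
  shows "D E (\<phi> + \<psi>) = D E \<phi> + D E \<psi>"
proof
  fix Z show "D E (\<phi> + \<psi>) Z = (D E \<phi> + D E \<psi>) Z"
  proof (cases "N Z = 0")
    case False
    have "((\<phi> + \<psi>) has_derivative (\<lambda>E. D E \<phi> Z + D E \<psi> Z)) (at Z)"
      unfolding plus_fun_def
      using has_derivative_D(1)[OF assms(1) False] has_derivative_D(1)[OF assms(2) False]
      by (rule has_derivative_add)
    from D_eqI[OF _ False this] show ?thesis using assms by simp
  qed simp
qed

lemma D_mult [simp]:
  assumes "\<phi> \<in> localized_poly" "\<psi> \<in> localized_poly"
  shows "D E (\<phi> * \<psi>) = \<phi> * D E \<psi> + D E \<phi> * \<psi>"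
proof
  fix Z show "D E (\<phi> * \<psi>) Z = (\<phi> * D E \<psi> + D E \<phi> * \<psi>) Z"
  proof (cases "N Z = 0")
    case False
    have "((\<phi> * \<psi>) has_derivative (\<lambda>E. \<phi> Z * D E \<psi> Z + D E \<phi> Z * \<psi> Z)) (at Z)"
      unfolding times_fun_def
      using has_derivative_D(1)[OF assms(1) False] has_derivative_D(1)[OF assms(2) False]
      by (rule has_derivative_mult)
    from D_eqI[OF _ False this] show ?thesis using assms by simp
  qed simp
qed

lemma D_uminus [simp]:
  assumes "\<phi> \<in> localized_poly"
  shows "D E (- \<phi>) = - D E \<phi>"
proof -
  have "D E (- \<phi>) + D E \<phi> = 0" using D_add[of "- \<phi>" \<phi> E] assms by simp
  then show ?thesis by (simp add: eq_neg_iff_add_eq_0)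
qed

lemma D_minus [simp]:
  "\<phi> \<in> localized_poly \<Longrightarrow> \<psi> \<in> localized_poly \<Longrightarrow> D E (\<phi> - \<psi>) = D E \<phi> - D E \<psi>"
  using D_add[of \<phi> "- \<psi>" E] by simp

lemma D_entry [simp]: "D E (entry i j) = cst (E $ i $ j)"
proof
  fix Z show "D E (entry i j) Z = cst (E $ i $ j) Z"
  proof (cases "N Z = 0")
    case False
    have "(entry i j has_derivative (\<lambda>E. E $ i $ j)) (at Z)"
      unfolding entry_def has_derivative_on_units[OF False] by (auto intro!: derivative_eq_intros)
    from D_eqI[OF entry_in False this] show ?thesis using False by simp
  qed (simp add: cst_def)
qed

text \<open>The derivative of the quadratic form \<open>N\<close> in the direction \<open>E\<close>.\<close>

definition polarN :: "HC \<Rightarrow> HC \<Rightarrow> complex"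
  where "polarN E = cst (E$1$1) * entry 2 2 + cst (E$2$2) * entry 1 1
    - cst (E$1$2) * entry 2 1 - cst (E$2$1) * entry 1 2"

lemma D_Ninv [simp]: "D E Ninv = - (polarN E * (Ninv * Ninv))"
proof
  fix Z show "D E Ninv Z = (- (polarN E * (Ninv * Ninv))) Z"
  proof (cases "N Z = 0")
    case False
    have "(Ninv has_derivative (\<lambda>E. - (inverse (N Z) * (E$1$1 * Z$2$2 + Z$1$1 * E$2$2
        - E$1$2 * Z$2$1 - Z$1$2 * E$2$1) * inverse (N Z)))) (at Z)"
      unfolding Ninv_def has_derivative_on_units[OF False]
      by (rule Deriv.has_derivative_inverse[OF False has_derivative_N])
    from D_eqI[OF Ninv_in False this] show ?thesis
      using False by (simp add: polarN_def algebra_simps)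
  qed (simp add: Ninv_def)
qed

text \<open>The coordinates \<open>z\<^sup>j\<close> are linear combinations of the matrix entries, which have simpler
  derivatives.\<close>

lemma localized_poly_generated:
  assumes "\<phi> \<in> localized_poly"
    and "\<And>c. P (cst c)" "\<And>i j. P (entry i j)" "P Ninv"
    and add: "\<And>\<phi> \<psi>. \<phi> \<in> localized_poly \<Longrightarrow> \<psi> \<in> localized_poly \<Longrightarrow> P \<phi> \<Longrightarrow> P \<psi> \<Longrightarrow> P (\<phi> + \<psi>)"
    and mult: "\<And>\<phi> \<psi>. \<phi> \<in> localized_poly \<Longrightarrow> \<psi> \<in> localized_poly \<Longrightarrow> P \<phi> \<Longrightarrow> P \<psi> \<Longrightarrow> P (\<phi> * \<psi>)"
  shows "P \<phi>"
proof -
  have z: "on_units z0 = cst (1/2) * (entry 1 1 + entry 2 2)"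
    "on_units z1 = cst (\<i>/2) * (entry 1 2 + entry 2 1)"
    "on_units z2 = cst (1/2) * (entry 2 1 + cst (-1) * entry 1 2)"
    "on_units z3 = cst (\<i>/2) * (entry 1 1 + cst (-1) * entry 2 2)"
    by (auto simp: fun_eq_iff entry_def cst_def on_units_def z0_def z1_def z2_def z3_def field_simps)
  have P_z: "P (on_units z0)" "P (on_units z1)" "P (on_units z2)" "P (on_units z3)"
    unfolding z by (intro add mult add_in mult_in cst_in entry_in assms(2,3))+
  show ?thesis
    using assms(1)
  proof (induction rule: localized_poly.induct)
    case (const c) show ?case using assms(2)[of c] by (simp only: cst_def)
  next
    case inverse_N show ?case using assms(4) by (simp only: Ninv_def)
  next
    case (add f g) then show ?case using assms(5)[of f g] by (simp only: plus_fun_def)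
  next
    case (mult f g) then show ?case using assms(6)[of f g] by (simp only: times_fun_def)
  qed (rule P_z)+
qed

lemma D_in [simp, intro]: "\<phi> \<in> localized_poly \<Longrightarrow> D E \<phi> \<in> localized_poly"
  by (erule localized_poly_generated[where P = "\<lambda>\<phi>. D E \<phi> \<in> localized_poly"])
    (simp_all add: polarN_def)

text \<open>The commutator of two derivations is a derivation, so it suffices to look at generators.\<close>

lemma D_commute:
  assumes "\<phi> \<in> localized_poly"
  shows "D E (D F \<phi>) = D F (D E \<phi>)"
  using assms
proof (rule localized_poly_generated[where P = "\<lambda>\<phi>. D E (D F \<phi>) = D F (D E \<phi>)"])
  show "D E (D F Ninv) = D F (D E Ninv)"
    by (rule localized_poly_eqI) (simp_all add: polarN_def)
next
  fix \<phi> \<psi> assume "\<phi> \<in> localized_poly" "\<psi> \<in> localized_poly"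
    "D E (D F \<phi>) = D F (D E \<phi>)" "D E (D F \<psi>) = D F (D E \<psi>)"
  then show "D E (D F (\<phi> * \<psi>)) = D F (D E (\<phi> * \<psi>))"
    by (simp add: fun_eq_iff algebra_simps)
qed simp_all

lemma D_direction_add:
  assumes "\<phi> \<in> localized_poly"
  shows "D (E + F) \<phi> = D E \<phi> + D F \<phi>"
proof
  fix Z show "D (E + F) \<phi> Z = (D E \<phi> + D F \<phi>) Z"
  proof (cases "N Z = 0")
    case False
    from has_derivative_D(1)[OF assms this] have "linear (\<lambda>E. D E \<phi> Z)"
      by (rule has_derivative_linear)
    then show ?thesis using linear_add[of "\<lambda>E. D E \<phi> Z" E F] by simp
  qed simp
qed

lemma D_direction_scale:
  assumes "\<phi> \<in> localized_poly"
  shows "D (mscale c E) \<phi> = cst c * D E \<phi>"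
proof
  fix Z show "D (mscale c E) \<phi> Z = (cst c * D E \<phi>) Z"
    using has_derivative_D(2)[OF assms, of Z c E] by (cases "N Z = 0") simp_all
qed

definition matrix_unit :: "2 \<Rightarrow> 2 \<Rightarrow> HC"
  where "matrix_unit i j = (\<chi> k l. if k = i \<and> l = j then 1 else 0)"

lemma matrix_unit_nth [simp]: "matrix_unit i j $ k $ l = (if k = i \<and> l = j then 1 else 0)"
  by (simp add: matrix_unit_def)

lemma D_matrix_units:
  assumes "\<phi> \<in> localized_poly"
  shows "D E \<phi> = cst (E$1$1) * D (matrix_unit 1 1) \<phi> + cst (E$1$2) * D (matrix_unit 1 2) \<phi>
    + cst (E$2$1) * D (matrix_unit 2 1) \<phi> + cst (E$2$2) * D (matrix_unit 2 2) \<phi>"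
proof -
  have "E = mscale (E$1$1) (matrix_unit 1 1) + mscale (E$1$2) (matrix_unit 1 2)
    + mscale (E$2$1) (matrix_unit 2 1) + mscale (E$2$2) (matrix_unit 2 2)"
    by (simp add: vec_eq_iff forall_2 mscale_def)
  then have "D E \<phi> = D (mscale (E$1$1) (matrix_unit 1 1) + mscale (E$1$2) (matrix_unit 1 2)
    + mscale (E$2$1) (matrix_unit 2 1) + mscale (E$2$2) (matrix_unit 2 2)) \<phi>" by simp
  then show ?thesis using assms by (simp only: D_direction_add D_direction_scale)
qed

lemma D_cong:
  assumes "\<And>Z. N Z \<noteq> 0 \<Longrightarrow> \<phi> Z = \<psi> Z"
  shows "D E \<phi> = D E \<psi>"
proof
  fix Z show "D E \<phi> Z = D E \<psi> Z"
  proof (cases "N Z = 0")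
    case False
    have "isCont (\<lambda>t. Z + mscale t E) 0"
      by (intro continuous_intros linear_continuous_at bounded_linear_mscale)
    moreover have "Z + mscale 0 E = Z" by (simp add: vec_eq_iff mscale_def)
    ultimately have "filterlim (\<lambda>t. Z + mscale t E) (nhds Z) (at 0)"
      by (simp only: isCont_def)
    then have "\<forall>\<^sub>F t in at 0. N (Z + mscale t E) \<noteq> 0"
      using eventually_unit[OF False] by (rule eventually_compose_filterlim[rotated])
    then have "\<forall>\<^sub>F t in nhds 0. N (Z + mscale t E) \<noteq> 0"
      unfolding eventually_at_filter
      by (rule eventually_mono) (use False \<open>Z + mscale 0 E = Z\<close> in auto)
    then have "\<forall>\<^sub>F t in nhds 0. \<phi> (Z + mscale t E) = \<psi> (Z + mscale t E)"
      by (rule eventually_mono) (rule assms)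
    then show ?thesis using False by (simp add: D_def deriv_cong_ev)
  qed simp
qed

section \<open>The defining equations in matrix coordinates\<close>

definition component :: "2 \<Rightarrow> spinor_fun \<Rightarrow> HC \<Rightarrow> complex"
  where "component k f = (\<lambda>Z. f Z $ k)"

lemma spinor_poly_component: "f \<in> spinor_poly \<longleftrightarrow> (\<forall>k. component k f \<in> localized_poly)"
  by (simp add: spinor_poly_def component_def)

text \<open>This is \<open>\<box> / 2\<close>. Both orders of differentiation appear because the squares of
  \<open>\<partial>\<^sub>1\<^sub>1 + \<partial>\<^sub>2\<^sub>2\<close> and of the other three coordinate derivatives are expanded as they stand.\<close>

definition half_box :: "(HC \<Rightarrow> complex) \<Rightarrow> HC \<Rightarrow> complex"
  where "half_box \<phi> =
      D (matrix_unit 1 1) (D (matrix_unit 2 2) \<phi>) + D (matrix_unit 2 2) (D (matrix_unit 1 1) \<phi>)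
    - D (matrix_unit 1 2) (D (matrix_unit 2 1) \<phi>) - D (matrix_unit 2 1) (D (matrix_unit 1 2) \<phi>)"

lemma half_box_in [simp]: "\<phi> \<in> localized_poly \<Longrightarrow> half_box \<phi> \<in> localized_poly"
  by (simp add: half_box_def)

lemma half_box_zero [simp]: "half_box 0 = 0"
  by (simp add: half_box_def)

lemma basis_entries [simp]:
  "e0 $ 1 $ 1 = 1" "e0 $ 1 $ 2 = 0" "e0 $ 2 $ 1 = 0" "e0 $ 2 $ 2 = 1"
  "e1 $ 1 $ 1 = 0" "e1 $ 1 $ 2 = - \<i>" "e1 $ 2 $ 1 = - \<i>" "e1 $ 2 $ 2 = 0"
  "e2 $ 1 $ 1 = 0" "e2 $ 1 $ 2 = -1" "e2 $ 2 $ 1 = 1" "e2 $ 2 $ 2 = 0"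
  "e3 $ 1 $ 1 = - \<i>" "e3 $ 1 $ 2 = 0" "e3 $ 2 $ 1 = 0" "e3 $ 2 $ 2 = \<i>"
  by (simp_all add: e0_def e1_def e2_def e3_def mat_def)

lemma partial_component: "N Z \<noteq> 0 \<Longrightarrow> partial E f Z $ k = D E (component k f) Z"
  by (simp add: partial_def D_def component_def)

lemma partial_partial_component:
  "N Z \<noteq> 0 \<Longrightarrow> partial E (partial F f) Z $ k = D E (D F (component k f)) Z"
proof -
  have "D E (component k (partial F f)) = D E (D F (component k f))"
    by (rule D_cong) (simp add: component_def[of k "partial F f"] partial_component)
  then show "N Z \<noteq> 0 \<Longrightarrow> ?thesis" by (simp add: partial_component)
qed

lemma box_component:
  assumes "f \<in> spinor_poly" "N Z \<noteq> 0"
  shows "box f Z $ k = 2 * half_box (component k f) Z"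
proof -
  define \<phi> where "\<phi> = component k f"
  have \<phi>: "\<phi> \<in> localized_poly" using assms by (simp add: \<phi>_def spinor_poly_component)
  have "D e0 (D e0 \<phi>) Z + D e1 (D e1 \<phi>) Z + D e2 (D e2 \<phi>) Z + D e3 (D e3 \<phi>) Z = 2 * half_box \<phi> Z"
    using \<phi> assms(2)
    by (simp add: D_matrix_units[of _ e0] D_matrix_units[of _ e1] D_matrix_units[of _ e2]
        D_matrix_units[of _ e3] half_box_def algebra_simps)
  then show ?thesis
    using assms(2) by (simp add: box_def partial_partial_component \<phi>_def)
qed

lemma partial_box_component:
  assumes "f \<in> spinor_poly" "N Z \<noteq> 0"
  shows "partial E (box f) Z $ k = 2 * D E (half_box (component k f)) Z"
proof -
  have \<phi>: "component k f \<in> localized_poly" using assms by (simp add: spinor_poly_component)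
  have "D E (component k (box f)) = D E (cst 2 * half_box (component k f))"
    by (rule D_cong) (simp add: component_def[of k "box f"] box_component assms(1))
  then show ?thesis using assms(2) \<phi> by (simp add: partial_component)
qed

lemma vector_2_eq_0_iff: "(vector [x, y] :: complex^2) = 0 \<longleftrightarrow> x = 0 \<and> y = 0"
  by (simp add: vec_eq_iff forall_2)

text \<open>In matrix coordinates \<open>\<nabla>\<close> is twice the transpose of the matrix of partial derivatives,
  so acting from the left and from the right differ by a transposition.\<close>

lemma U_l_iff:
  "f \<in> U_l \<longleftrightarrow> f \<in> spinor_poly \<and> (\<forall>Z. N Z \<noteq> 0 \<longrightarrow>
     D (matrix_unit 1 1) (half_box (component 1 f)) Z + D (matrix_unit 2 1) (half_box (component 2 f)) Z = 0 \<and>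
     D (matrix_unit 1 2) (half_box (component 1 f)) Z + D (matrix_unit 2 2) (half_box (component 2 f)) Z = 0)"
proof (cases "f \<in> spinor_poly")
  case True
  then have \<phi>: "component k f \<in> localized_poly" for k by (simp add: spinor_poly_component)
  have "nabla_l (box f) Z = 4 *s vector
     [D (matrix_unit 1 1) (half_box (component 1 f)) Z + D (matrix_unit 2 1) (half_box (component 2 f)) Z,
      D (matrix_unit 1 2) (half_box (component 1 f)) Z + D (matrix_unit 2 2) (half_box (component 2 f)) Z]"
    if "N Z \<noteq> 0" for Z
    using that \<phi> True
    by (simp add: nabla_l_def vec_eq_iff forall_2 matrix_vector_mult_def sum_2 partial_box_component
        D_matrix_units[of _ e0] D_matrix_units[of _ e1] D_matrix_units[of _ e2]
        D_matrix_units[of _ e3] algebra_simps)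
  then show ?thesis using True unfolding U_l_def by (simp add: vector_2_eq_0_iff)
qed (simp add: U_l_def)

lemma U_r_iff:
  "f \<in> U_r \<longleftrightarrow> f \<in> spinor_poly \<and> (\<forall>Z. N Z \<noteq> 0 \<longrightarrow>
     D (matrix_unit 1 1) (half_box (component 1 f)) Z + D (matrix_unit 1 2) (half_box (component 2 f)) Z = 0 \<and>
     D (matrix_unit 2 1) (half_box (component 1 f)) Z + D (matrix_unit 2 2) (half_box (component 2 f)) Z = 0)"
proof (cases "f \<in> spinor_poly")
  case True
  then have \<phi>: "component k f \<in> localized_poly" for k by (simp add: spinor_poly_component)
  have "nabla_r (box f) Z = 4 *s vector
     [D (matrix_unit 1 1) (half_box (component 1 f)) Z + D (matrix_unit 1 2) (half_box (component 2 f)) Z,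
      D (matrix_unit 2 1) (half_box (component 1 f)) Z + D (matrix_unit 2 2) (half_box (component 2 f)) Z]"
    if "N Z \<noteq> 0" for Z
    using that \<phi> True
    by (simp add: nabla_r_def vec_eq_iff forall_2 vector_matrix_mult_def sum_2 partial_box_component
        D_matrix_units[of _ e0] D_matrix_units[of _ e1] D_matrix_units[of _ e2]
        D_matrix_units[of _ e3] algebra_simps)
  then show ?thesis using True unfolding U_r_def by (simp add: vector_2_eq_0_iff)
qed (simp add: U_r_def)


section \<open>The differentiated action\<close>

lemma has_derivative_vec:
  fixes f :: "'a::real_normed_vector \<Rightarrow> 'b::euclidean_space^'n"
  assumes "\<And>k. ((\<lambda>x. f x $ k) has_derivative (\<lambda>x. f' x $ k)) (at x within S)"
  shows "(f has_derivative f') (at x within S)"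
  unfolding has_derivative_componentwise_within[of f]
  by (auto simp: Basis_vec_def inner_axis intro!: has_derivative_inner_left assms)

definition blocks :: "HC \<Rightarrow> HC \<Rightarrow> HC \<Rightarrow> HC \<Rightarrow> gl2HC"
  where "blocks A B C E = (\<chi> i j. case i of
      Inl i \<Rightarrow> (case j of Inl j \<Rightarrow> A $ i $ j | Inr j \<Rightarrow> B $ i $ j)
    | Inr i \<Rightarrow> (case j of Inl j \<Rightarrow> C $ i $ j | Inr j \<Rightarrow> E $ i $ j))"

lemma block_blocks [simp]:
  "block11 (blocks A B C E) = A" "block12 (blocks A B C E) = B"
  "block21 (blocks A B C E) = C" "block22 (blocks A B C E) = E"
  by (simp_all add: block11_def block12_def block21_def block22_def blocks_def vec_eq_iff)

lemma blocks_eqI: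
  assumes "block11 h = block11 k" "block12 h = block12 k" "block21 h = block21 k" "block22 h = block22 k"
  shows "h = k"
proof -
  have "h $ i $ j = k $ i $ j" for i j
    using assms by (cases i; cases j) (simp_all add: block11_def block12_def block21_def block22_def vec_eq_iff)
  then show ?thesis by (simp add: vec_eq_iff)
qed

lemma mat_1_nth [simp]: "(mat 1 :: HC) $ i $ j = (if i = j then 1 else 0)"
  by (simp add: mat_def)

lemma block_mat_1 [simp]:
  "block11 (mat 1) = mat 1" "block12 (mat 1) = 0" "block21 (mat 1) = 0" "block22 (mat 1) = mat 1"
  by (simp_all add: block11_def block12_def block21_def block22_def mat_def vec_eq_iff)

lemma block_uminus [simp]:
  "block11 (- h) = - block11 h" "block12 (- h) = - block12 h"
  "block21 (- h) = - block21 h" "block22 (- h) = - block22 h"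
  by (simp_all add: block11_def block12_def block21_def block22_def vec_eq_iff)

lemma block_add [simp]:
  "block11 (h + k) = block11 h + block11 k" "block12 (h + k) = block12 h + block12 k"
  "block21 (h + k) = block21 h + block21 k" "block22 (h + k) = block22 h + block22 k"
  by (simp_all add: block11_def block12_def block21_def block22_def vec_eq_iff)

lemma block_scaleR [simp]:
  "block11 (r *\<^sub>R h) = r *\<^sub>R block11 h" "block12 (r *\<^sub>R h) = r *\<^sub>R block12 h"
  "block21 (r *\<^sub>R h) = r *\<^sub>R block21 h" "block22 (r *\<^sub>R h) = r *\<^sub>R block22 h"
  by (simp_all add: block11_def block12_def block21_def block22_def vec_eq_iff)

lemma has_derivative_block [derivative_intros]:
  "(block11 has_derivative block11) F" "(block12 has_derivative block12) F"
  "(block21 has_derivative block21) F" "(block22 has_derivative block22) F"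
proof -
  have "linear block11" "linear block12" "linear block21" "linear block22"
    by (auto intro!: linearI)
  then show "(block11 has_derivative block11) F" "(block12 has_derivative block12) F"
    "(block21 has_derivative block21) F" "(block22 has_derivative block22) F"
    by (auto intro!: bounded_linear_imp_has_derivative simp: linear_conv_bounded_linear)
qed

text \<open>The derivatives at the identity, in the direction \<open>Y\<close>, of \<open>a' - Z c'\<close> and of \<open>- b' + Z d'\<close>.\<close>

definition dfactor :: "gl2HC \<Rightarrow> HC \<Rightarrow> HC"
  where "dfactor Y Z = block11 Y - Z ** block21 Y"

definition dnumerator :: "gl2HC \<Rightarrow> HC \<Rightarrow> HC"
  where "dnumerator Y Z = - block12 Y + Z ** block22 Y"

definition infinitesimal_pi_l :: "gl2HC \<Rightarrow> spinor_fun \<Rightarrow> HC \<Rightarrow> complex^2"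
  where "infinitesimal_pi_l Y f Z = (\<chi> k.
    (dfactor Y Z *v f Z) $ k - (dfactor Y Z $ 1 $ 1 + dfactor Y Z $ 2 $ 2) * f Z $ k
    + D (dnumerator Y Z - dfactor Y Z ** Z) (component k f) Z)"

lemma has_derivative_pi_l:
  assumes f: "f \<in> spinor_poly" and Z: "N Z \<noteq> 0"
  shows "((\<lambda>h. pi_l h f Z) has_derivative (\<lambda>Y. infinitesimal_pi_l Y f Z)) (at (mat 1))"
proof (rule has_derivative_vec)
  fix k
  define w where "w h = block11 h - Z ** block21 h" for h
  define p where "p h = matrix_inv (w h) ** (- block12 h + Z ** block22 h)" for h
  have w1: "w (mat 1) = mat 1" and p1: "p (mat 1) = Z"
    by (simp_all add: w_def p_def matrix_inv_eqI)
  have dw: "(w has_derivative (\<lambda>Y. dfactor Y Z)) (at (mat 1))"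
    unfolding w_def dfactor_def by (auto intro!: derivative_eq_intros)
  have dinv: "((\<lambda>h. matrix_inv (w h)) has_derivative (\<lambda>Y. - dfactor Y Z)) (at (mat 1))"
    by (rule has_derivative_compose[OF dw]) (simp add: w1 has_derivative_matrix_inv_1)
  have dN: "((\<lambda>h. N (w h)) has_derivative (\<lambda>Y. dfactor Y Z $ 1 $ 1 + dfactor Y Z $ 2 $ 2)) (at (mat 1))"
    using has_derivative_compose[OF dw has_derivative_N] by (simp add: w1)
  have num: "((\<lambda>h. - block12 h + Z ** block22 h) has_derivative (\<lambda>Y. dnumerator Y Z)) (at (mat 1))"
    unfolding dnumerator_def by (auto intro!: derivative_eq_intros)
  have dp: "(p has_derivative (\<lambda>Y. dnumerator Y Z - dfactor Y Z ** Z)) (at (mat 1))"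
    unfolding p_def using has_derivative_matrix_mul[OF dinv num]
    by (simp add: w1 matrix_inv_eqI bounded_bilinear.minus_left[OF bounded_bilinear_matrix_mul])
  have df: "((\<lambda>h. f (p h) $ j) has_derivative
      (\<lambda>Y. D (dnumerator Y Z - dfactor Y Z ** Z) (component j f) Z)) (at (mat 1))" for j
  proof -
    have "component j f \<in> localized_poly" using f by (simp add: spinor_poly_component)
    from has_derivative_D(1)[OF this Z] show ?thesis
      using has_derivative_compose[OF dp, of "component j f"] by (simp add: p1 component_def)
  qed
  have "pi_l h f Z $ k = inverse (N (w h)) * (w h $ k $ 1 * f (p h) $ 1 + w h $ k $ 2 * f (p h) $ 2)" for h
    by (simp add: pi_l_def Let_def w_def p_def matrix_vector_mult_def sum_2)
  moreover have "((\<lambda>h. inverse (N (w h)) * (w h $ k $ 1 * f (p h) $ 1 + w h $ k $ 2 * f (p h) $ 2))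
      has_derivative (\<lambda>Y. infinitesimal_pi_l Y f Z $ k)) (at (mat 1))"
    by (rule derivative_eq_intros dN df dw refl | simp add: w1)+
      (use exhaust_2[of k] in \<open>auto simp: w1 p1 infinitesimal_pi_l_def matrix_vector_mult_def
        sum_2 algebra_simps fun_eq_iff\<close>)
  ultimately show "((\<lambda>h. pi_l h f Z $ k) has_derivative (\<lambda>Y. infinitesimal_pi_l Y f Z $ k)) (at (mat 1))"
    by simp
qed

lemma lie_action_pi_l:
  assumes "f \<in> spinor_poly"
  shows "lie_action pi_l Y f = on_units (infinitesimal_pi_l Y f)"
proof
  fix Z show "lie_action pi_l Y f Z = on_units (infinitesimal_pi_l Y f) Z"
    using frechet_derivative_at[OF has_derivative_pi_l[OF assms, of Z]]
    by (cases "N Z = 0") (simp_all add: lie_action_def fun_eq_iff)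
qed

section \<open>Transposition exchanges the two actions\<close>

definition transposed :: "spinor_fun \<Rightarrow> spinor_fun"
  where "transposed f = (\<lambda>Z. f (transpose Z))"

text \<open>This is \<open>J h\<^sup>T J\<^sup>-\<^sup>1\<close>, where \<open>J\<close> has the blocks \<open>0, 1, -1, 0\<close>: an antiautomorphism, which
  becomes an automorphism of the group when combined with inversion.\<close>

definition swap_blocks :: "gl2HC \<Rightarrow> gl2HC"
  where "swap_blocks h = blocks (transpose (block22 h)) (- transpose (block12 h))
    (- transpose (block21 h)) (transpose (block11 h))"

lemma matrix_inv_transpose:
  fixes A :: "complex^'n^'n"
  assumes "det A \<noteq> 0"
  shows "matrix_inv (transpose A) = transpose (matrix_inv A)"
proof (rule matrix_inv_eqI)
  have "matrix_inv A ** A = mat 1" using assms by (simp add: matrix_inv_left invertible_det_nz)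
  then show "transpose A ** transpose (matrix_inv A) = mat 1"
    by (simp flip: matrix_transpose_mul)
qed

lemma transpose_uminus: "transpose (- A) = - transpose (A :: 'a::ab_group_add^'n^'m)"
  and transpose_add: "transpose (A + B) = transpose A + transpose (B :: 'a::ab_group_add^'n^'m)"
  by (simp_all add: transpose_def vec_eq_iff)

text \<open>Transposing \<open>(a Z + b) (c Z + d)\<^sup>-\<^sup>1\<close> moves the inverse to the left, as in \<open>\<pi>'\<^sub>l\<close>. When \<open>c Z + d\<close> is
  singular, both sides vanish because of the factor \<open>inverse 0 = 0\<close>.\<close>

lemma pi_r_transposed:
  "pi_r h (transposed f) Z = pi_l (swap_blocks (matrix_inv h)) f (transpose Z)"
proof -
  define k where "k = matrix_inv h"
  define w where "w = block21 k ** Z + block22 k"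
  have w': "transpose (block22 k) - transpose Z ** (- transpose (block21 k)) = transpose w"
    by (simp add: w_def transpose_add matrix_transpose_mul
        bounded_bilinear.minus_right[OF bounded_bilinear_matrix_mul])
  have "matrix_inv (transpose w) ** (transpose Z ** transpose (block11 k) + transpose (block12 k))
      = transpose ((block11 k ** Z + block12 k) ** matrix_inv w)" if "N w \<noteq> 0"
    using that by (simp add: matrix_inv_transpose matrix_transpose_mul transpose_add)
  then show ?thesis
    by (cases "N w = 0")
      (simp_all add: pi_r_def pi_l_def Let_def k_def[symmetric] w_def[symmetric] swap_blocks_def w'
        transposed_def det_transpose)
qed

lemma has_derivative_swap_blocks: "(swap_blocks has_derivative swap_blocks) F"
proof -
  have "linear swap_blocks"
    by (intro linearI blocks_eqI)
      (simp_all add: swap_blocks_def transpose_def vec_eq_iff)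
  then show ?thesis
    by (auto intro!: bounded_linear_imp_has_derivative simp: linear_conv_bounded_linear)
qed

lemma lie_action_pi_r_transposed:
  assumes f: "f \<in> spinor_poly"
  shows "lie_action pi_r Y (transposed f) = transposed (lie_action pi_l (swap_blocks (- Y)) f)"
proof
  fix Z
  show "lie_action pi_r Y (transposed f) Z = transposed (lie_action pi_l (swap_blocks (- Y)) f) Z"
  proof (cases "N Z = 0")
    case False
    then have Z: "N (transpose Z) \<noteq> 0" by (simp add: det_transpose)
    have "swap_blocks (mat 1) = mat 1"
      by (rule blocks_eqI) (simp_all add: swap_blocks_def, simp_all add: transpose_def vec_eq_iff)
    then have "((\<lambda>h. pi_l h f (transpose Z)) has_derivative (\<lambda>Y. infinitesimal_pi_l Y f (transpose Z)))
        (at (swap_blocks (matrix_inv (mat 1))))"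
      using has_derivative_pi_l[OF f Z] by (simp add: matrix_inv_eqI)
    from has_derivative_compose[OF has_derivative_compose[OF has_derivative_matrix_inv_1
          has_derivative_swap_blocks] this]
    have "((\<lambda>h. pi_r h (transposed f) Z) has_derivative
        (\<lambda>Y. infinitesimal_pi_l (swap_blocks (- Y)) f (transpose Z))) (at (mat 1))"
      by (simp add: pi_r_transposed)
    from frechet_derivative_at[OF this] show ?thesis
      using False Z f by (simp add: lie_action_def[of pi_r] transposed_def lie_action_pi_l fun_eq_iff)
  qed (simp add: lie_action_def transposed_def det_transpose)
qed


lemma spinor_poly_subspace: "spinor_fun.subspace spinor_poly"
proof (rule spinor_fun.subspaceI)
  show "0 \<in> spinor_poly" using zero_in by (simp add: spinor_poly_def zero_fun_def)
  fix f g assume fg: "f \<in> spinor_poly" "g \<in> spinor_poly"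
  then show "f + g \<in> spinor_poly" by (simp add: spinor_poly_def localized_poly.add)
next
  fix c f assume f: "f \<in> spinor_poly"
  have "component k (fscale c f) = cst c * component k f" for k
    using f localized_poly_off_units
    by (auto simp: fun_eq_iff component_def fscale_def cst_def on_units_def spinor_poly_def)
  then show "fscale c f \<in> spinor_poly" using f by (simp add: spinor_poly_component)
qed

lemma on_units_transpose: "on_units \<phi> (transpose Z) = on_units (\<lambda>Z. \<phi> (transpose Z)) Z"
  by (simp add: on_units_def det_transpose)

lemma localized_poly_transpose:
  "\<phi> \<in> localized_poly \<Longrightarrow> (\<lambda>Z. \<phi> (transpose Z)) \<in> localized_poly"
proof (induction rule: localized_poly.induct)
  have z: "z0 (transpose Z) = z0 Z" "z1 (transpose Z) = z1 Z" "z2 (transpose Z) = - z2 Z"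
    "z3 (transpose Z) = z3 Z" for Z
    by (simp_all add: z0_def z1_def z2_def z3_def transpose_def add.commute field_simps)
  case coord0 show ?case by (simp add: on_units_transpose z localized_poly.coord0)
  case coord1 show ?case by (simp add: on_units_transpose z localized_poly.coord1)
  case coord2
  have "(\<lambda>Z. on_units z2 (transpose Z)) = - on_units z2"
    by (simp add: on_units_transpose z fun_eq_iff) (simp add: on_units_def)
  with uminus_in[OF localized_poly.coord2] show ?case by (simp only:)
  case coord3 show ?case by (simp add: on_units_transpose z localized_poly.coord3)
qed (simp_all add: on_units_transpose det_transpose localized_poly.intros)

lemma D_transpose: "D E (\<lambda>Z. \<phi> (transpose Z)) = (\<lambda>Z. D (transpose E) \<phi> (transpose Z))"
proof -
  have "transpose (Z + mscale t E) = transpose Z + mscale t (transpose E)" for Z t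
    by (simp add: vec_eq_iff transpose_def mscale_def)
  then show ?thesis by (simp add: D_def on_units_transpose fun_eq_iff)
qed

lemma transpose_matrix_unit: "transpose (matrix_unit i j) = matrix_unit j i"
  by (auto simp: vec_eq_iff transpose_def)

lemma half_box_transpose:
  "half_box (\<lambda>Z. \<phi> (transpose Z)) = (\<lambda>Z. half_box \<phi> (transpose Z))"
  by (simp add: half_box_def D_transpose transpose_matrix_unit fun_eq_iff algebra_simps)

lemma component_transposed: "component k (transposed f) = (\<lambda>Z. component k f (transpose Z))"
  by (simp add: component_def transposed_def)

lemma transposed_in_U_r: "f \<in> U_l \<Longrightarrow> transposed f \<in> U_r"
  unfolding U_l_iff U_r_iff
  by (simp add: spinor_poly_component component_transposed localized_poly_transpose
      half_box_transpose D_transpose transpose_matrix_unit det_transpose)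

lemma homogeneous_transposed: "homogeneous d f \<Longrightarrow> homogeneous d (transposed f)"
proof -
  have "transpose (mscale c Z) = mscale c (transpose Z)" for c Z
    by (simp add: vec_eq_iff transpose_def mscale_def)
  then show "homogeneous d f \<Longrightarrow> ?thesis"
    by (simp add: homogeneous_def transposed_def det_transpose)
qed

lemma transposed_add [simp]: "transposed (f + g) = transposed f + transposed g"
  and transposed_fscale [simp]: "transposed (fscale c f) = fscale c (transposed f)"
  and transposed_0 [simp]: "transposed 0 = 0"
  and transposed_transposed [simp]: "transposed (transposed f) = f"
  by (simp_all add: transposed_def fscale_def fun_eq_iff)

lemma transposed_in_span:
  assumes "f \<in> spinor_fun.span S" "transposed ` S \<subseteq> S'"
  shows "transposed f \<in> spinor_fun.span S'"
  using assms(1)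
proof (induction rule: spinor_fun.span_induct_alt)
  case (step c x y)
  have "fscale c (transposed x) + transposed y \<in> spinor_fun.span S'"
    by (intro spinor_fun.span_add[OF spinor_fun.span_scale[OF spinor_fun.span_base]])
      (use step assms(2) in blast)+
  then show ?case by (simp only: transposed_add transposed_fscale)
qed (simp only: transposed_0 spinor_fun.span_zero)

lemma transposed_in_U_r_plus: "f \<in> U_l_plus \<Longrightarrow> transposed f \<in> U_r_plus"
  unfolding U_l_plus_def U_r_plus_def
  by (erule transposed_in_span) (auto dest: transposed_in_U_r homogeneous_transposed)

lemma transposed_in_U_r_minus: "f \<in> U_l_minus \<Longrightarrow> transposed f \<in> U_r_minus"
  unfolding U_l_minus_def U_r_minus_def
  by (erule transposed_in_span) (auto dest: transposed_in_U_r homogeneous_transposed)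

lemma U_l_plus_spinor_poly: "U_l_plus \<subseteq> spinor_poly"
  and U_l_minus_spinor_poly: "U_l_minus \<subseteq> spinor_poly"
proof -
  have "U_l \<subseteq> spinor_poly" by (auto simp: U_l_def)
  then have "{f \<in> U_l. P f} \<subseteq> spinor_poly" for P by auto
  then show "U_l_plus \<subseteq> spinor_poly" "U_l_minus \<subseteq> spinor_poly"
    unfolding U_l_plus_def U_l_minus_def
    by (intro spinor_fun.span_minimal spinor_poly_subspace; assumption)+
qed

lemma swap_blocks_u22:
  assumes "Y \<in> u22"
  shows "swap_blocks (- Y) \<in> u22"
proof -
  have "block11 Y = - ctranspose (block11 Y)" "block22 Y = - ctranspose (block22 Y)"
    "block21 Y = ctranspose (block12 Y)"
    using assms unfolding u22_def by blast+
  then have e: "block11 Y $ i $ j = (- ctranspose (block11 Y)) $ i $ j"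
    "block22 Y $ i $ j = (- ctranspose (block22 Y)) $ i $ j"
    "block21 Y $ i $ j = ctranspose (block12 Y) $ i $ j" for i j
    by (metis (no_types))+
  have "block11 (swap_blocks (- Y)) $ i $ j = (- ctranspose (block11 (swap_blocks (- Y)))) $ i $ j"
    "block22 (swap_blocks (- Y)) $ i $ j = (- ctranspose (block22 (swap_blocks (- Y)))) $ i $ j"
    "block21 (swap_blocks (- Y)) $ i $ j = ctranspose (block12 (swap_blocks (- Y))) $ i $ j" for i j
    using e(1)[of j i] e(2)[of j i] e(3)[of j i]
    by (simp_all add: swap_blocks_def transpose_def ctranspose_def)
  then show ?thesis unfolding u22_def mem_Collect_eq vec_eq_iff by blast
qed

lemma hermitian_inner_product_onD:
  assumes "hermitian_inner_product_on V B"
  shows "u \<in> V \<Longrightarrow> v \<in> V \<Longrightarrow> w \<in> V \<Longrightarrow> B (u + v) w = B u w + B v w"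
    and "u \<in> V \<Longrightarrow> v \<in> V \<Longrightarrow> B (fscale c u) v = c * B u v"
    and "u \<in> V \<Longrightarrow> v \<in> V \<Longrightarrow> B v u = cnj (B u v)"
    and "u \<in> V \<Longrightarrow> u \<noteq> 0 \<Longrightarrow> B u u \<in> \<real> \<and> Re (B u u) > 0"
proof -
  note inner = assms[unfolded hermitian_inner_product_on_def]
  show "u \<in> V \<Longrightarrow> v \<in> V \<Longrightarrow> w \<in> V \<Longrightarrow> B (u + v) w = B u w + B v w"
    using inner[THEN conjunct1] by blast
  show "u \<in> V \<Longrightarrow> v \<in> V \<Longrightarrow> B (fscale c u) v = c * B u v"
    using inner[THEN conjunct2, THEN conjunct1] by blast
  show "u \<in> V \<Longrightarrow> v \<in> V \<Longrightarrow> B v u = cnj (B u v)"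
    using inner[THEN conjunct2, THEN conjunct2, THEN conjunct1, THEN bspec, THEN bspec] .
  show "u \<in> V \<Longrightarrow> u \<noteq> 0 \<Longrightarrow> B u u \<in> \<real> \<and> Re (B u u) > 0"
    using inner[THEN conjunct2, THEN conjunct2, THEN conjunct2] by blast
qed

text \<open>Pulling back along transposition turns a unitary structure for \<open>\<pi>'\<^sub>r\<close> into one for \<open>\<pi>'\<^sub>l\<close>,
  so only the left action has to be refuted.\<close>

lemma unitary_structure_transposed:
  assumes B: "u22_invariant_unitary_structure (lie_action pi_r) V' B"
    and V: "V \<subseteq> spinor_poly" "\<And>f. f \<in> V \<Longrightarrow> transposed f \<in> V'"
  shows "u22_invariant_unitary_structure (lie_action pi_l) V
    (\<lambda>u v. B (transposed u) (transposed v))"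
proof -
  have inner: "hermitian_inner_product_on V' B"
    and inv: "\<And>Y u v. Y \<in> u22 \<Longrightarrow> u \<in> V' \<Longrightarrow> v \<in> V' \<Longrightarrow>
      B (lie_action pi_r Y u) v + B u (lie_action pi_r Y v) = 0"
    using B by (auto simp: u22_invariant_unitary_structure_def)
  have "hermitian_inner_product_on V (\<lambda>u v. B (transposed u) (transposed v))"
  proof -
    have "u = 0" if "transposed u = 0" for u
    proof -
      have "u = transposed 0" unfolding that[symmetric] by (rule transposed_transposed[symmetric])
      then show ?thesis by (simp only: transposed_0)
    qed
    then have pos: "B (transposed u) (transposed u) \<in> \<real> \<and> Re (B (transposed u) (transposed u)) > 0"
      if "u \<in> V" "u \<noteq> 0" for u
      using hermitian_inner_product_onD(4)[OF inner V(2)] that by blast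
    note B' = hermitian_inner_product_onD[OF inner V(2)]
    show ?thesis
      unfolding hermitian_inner_product_on_def transposed_add transposed_fscale
      by (intro conjI ballI allI impI B'(1)[OF _ V(2) V(2)] B'(2)[OF _ V(2)] B'(3)[OF _ V(2)])
        (assumption | rule pos[THEN conjunct1] pos[THEN conjunct2])+
  qed
  moreover have "B (transposed (lie_action pi_l Y u)) (transposed v)
      + B (transposed u) (transposed (lie_action pi_l Y v)) = 0"
    if Y: "Y \<in> u22" and uv: "u \<in> V" "v \<in> V" for Y u v
  proof -
    define Y' where "Y' = swap_blocks (- Y)"
    have "swap_blocks (- Y') = Y"
      by (rule blocks_eqI) (simp_all add: Y'_def swap_blocks_def transpose_uminus)
    then have act: "transposed (lie_action pi_l Y f) = lie_action pi_r Y' (transposed f)" if "f \<in> V" for f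
      using lie_action_pi_r_transposed[of f Y'] V(1) that by auto
    have "Y' \<in> u22"
      unfolding Y'_def using Y by (rule swap_blocks_u22)
    then show ?thesis using inv V(2) uv by (simp add: act)
  qed
  ultimately show ?thesis by (simp add: u22_invariant_unitary_structure_def)
qed


section \<open>The noncompact part of the Lie algebra\<close>

definition noncompact :: "HC \<Rightarrow> gl2HC"
  where "noncompact B = blocks 0 B (ctranspose B) 0"

lemma noncompact_in_u22: "noncompact B \<in> u22"
  by (simp add: u22_def noncompact_def ctranspose_def vec_eq_iff)

text \<open>The parts of the differentiated action that belong to the upper right block \<open>B\<close> and to the lower
  left block \<open>C\<close>: the operators \<open>P\<^sub>B\<close> and \<open>K\<^sub>C\<close>.\<close>

definition translation_action :: "HC \<Rightarrow> spinor_fun \<Rightarrow> spinor_fun"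
  where "translation_action B f = on_units (\<lambda>Z. \<chi> k. - D B (component k f) Z)"

definition inverted_translation_action :: "HC \<Rightarrow> spinor_fun \<Rightarrow> spinor_fun"
  where "inverted_translation_action C f = on_units (\<lambda>Z. \<chi> k.
    trace (Z ** C) * f Z $ k - ((Z ** C) *v f Z) $ k + D (Z ** C ** Z) (component k f) Z)"

lemma matrix_vector_mult_minus_left: "(- A :: HC) *v x = - (A *v x)"
  by (simp add: vec_eq_iff matrix_vector_mult_def sum_negf)

lemma lie_action_noncompact:
  assumes f: "f \<in> spinor_poly"
  shows "lie_action pi_l (noncompact B) f
    = translation_action B f + inverted_translation_action (ctranspose B) f"
proof -
  have D: "D (V - W) (component k f) Z = D V (component k f) Z - D W (component k f) Z"
    if "N Z \<noteq> 0" for k V W Z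
  proof -
    have "V - W = V + mscale (-1) W" by (simp add: vec_eq_iff)
    moreover have "component k f \<in> localized_poly" using f by (simp add: spinor_poly_component)
    ultimately show ?thesis
      using that by (simp only: D_direction_add D_direction_scale) simp
  qed
  show ?thesis
  proof
    fix Z
    have "dfactor (noncompact B) Z = - (Z ** ctranspose B)"
      "dnumerator (noncompact B) Z - - (Z ** ctranspose B) ** Z = Z ** ctranspose B ** Z - B"
      by (simp_all add: dfactor_def dnumerator_def noncompact_def
          bounded_bilinear.minus_left[OF bounded_bilinear_matrix_mul])
    then have "infinitesimal_pi_l (noncompact B) f Z $ k = trace (Z ** ctranspose B) * f Z $ k
        - ((Z ** ctranspose B) *v f Z) $ k
        + D (Z ** ctranspose B ** Z - B) (component k f) Z" for k
      unfolding infinitesimal_pi_l_def trace_def sum_2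
      by (simp only: matrix_vector_mult_minus_left vec_lambda_beta vector_uminus_component)
        (simp, simp add: algebra_simps)
    then show "lie_action pi_l (noncompact B) f Z
        = (translation_action B f + inverted_translation_action (ctranspose B) f) Z"
      using f by (cases "N Z = 0")
        (simp_all add: lie_action_pi_l translation_action_def inverted_translation_action_def D vec_eq_iff)
  qed
qed

lemma translation_action_scale:
  assumes "f \<in> spinor_poly"
  shows "translation_action (mscale c B) f = fscale c (translation_action B f)"
proof
  fix Z show "translation_action (mscale c B) f Z = fscale c (translation_action B f) Z"
    using assms by (cases "N Z = 0")
      (simp_all add: translation_action_def fscale_def spinor_poly_component D_direction_scale vec_eq_iff)
qed

lemma inverted_translation_action_scale:
  assumes "f \<in> spinor_poly"
  shows "inverted_translation_action (mscale c C) f = fscale c (inverted_translation_action C f)"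
proof
  fix Z
  have "Z ** mscale c C = mscale c (Z ** C)" "mscale c A ** Z = mscale c (A ** Z)"
    "mscale c A *v v = c *s (A *v v)" "trace (mscale c A) = c * trace A" for A v
    by (simp_all add: vec_eq_iff mscale_def matrix_matrix_mult_def matrix_vector_mult_def trace_def
        sum_distrib_left mult_ac)
  then show "inverted_translation_action (mscale c C) f Z = fscale c (inverted_translation_action C f) Z"
    using assms by (cases "N Z = 0")
      (simp_all add: inverted_translation_action_def fscale_def spinor_poly_component
        D_direction_scale, simp add: vec_eq_iff algebra_simps)
qed

lemma ctranspose_mscale: "ctranspose (mscale c B) = mscale (cnj c) (ctranspose B)"
  by (simp add: ctranspose_def mscale_def vec_eq_iff)

text \<open>Averaging the invariance under \<open>noncompact B\<close> with that under \<open>noncompact (\<i> B)\<close> separates the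
  part that is complex linear in \<open>B\<close> from the part that is antilinear.\<close>

lemma translation_adjoint:
  assumes unitary: "u22_invariant_unitary_structure (lie_action pi_l) V B"
    and V: "spinor_fun.subspace V" "V \<subseteq> spinor_poly"
    and uv: "u \<in> V" "v \<in> V"
    and P: "translation_action A u \<in> V" "translation_action A v \<in> V"
    and K: "inverted_translation_action (ctranspose A) u \<in> V"
      "inverted_translation_action (ctranspose A) v \<in> V"
  shows "B (translation_action A u) v = - B u (inverted_translation_action (ctranspose A) v)"
proof -
  let ?P = "translation_action A" and ?K = "inverted_translation_action (ctranspose A)"
  have inner: "hermitian_inner_product_on V B"
    and inv: "\<And>Y u v. Y \<in> u22 \<Longrightarrow> u \<in> V \<Longrightarrow> v \<in> V \<Longrightarrow>
      B (lie_action pi_l Y u) v + B u (lie_action pi_l Y v) = 0"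
    using unitary unfolding u22_invariant_unitary_structure_def by blast+
  note add = hermitian_inner_product_onD(1)[OF inner] and scale = hermitian_inner_product_onD(2)[OF inner]
    and herm = hermitian_inner_product_onD(3)[OF inner]
  have scale_in: "fscale c w \<in> V" if "w \<in> V" for c w
    using spinor_fun.subspace_scale[OF V(1) that] .
  have add_in: "w + w' \<in> V" if "w \<in> V" "w' \<in> V" for w w'
    using spinor_fun.subspace_add[OF V(1) that] .
  have add2: "B w (w' + w'') = B w w' + B w w''" if "w \<in> V" "w' \<in> V" "w'' \<in> V" for w w' w''
    using herm[of "w' + w''" w] herm[of w' w] herm[of w'' w] add[of w' w'' w] add_in that by simp
  have scale2: "B w (fscale c w') = cnj c * B w w'" if "w \<in> V" "w' \<in> V" for c w w'
    using herm[of "fscale c w'" w] herm[of w' w] scale[of w' w c] scale_in that by simp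
  have act: "lie_action pi_l (noncompact (mscale c A)) w = fscale c (?P w) + fscale (cnj c) (?K w)"
    if "w \<in> V" for c w
  proof -
    have "w \<in> spinor_poly" using that V(2) by blast
    then show ?thesis
      by (simp only: lie_action_noncompact translation_action_scale ctranspose_mscale
          inverted_translation_action_scale)
  qed
  have "c * B (?P u) v + cnj c * B (?K u) v + (cnj c * B u (?P v) + c * B u (?K v)) = 0" for c
    using inv[OF noncompact_in_u22 uv, of "mscale c A"] uv P K
    by (simp only: act add add2 scale scale2 scale_in complex_cnj_cnj)
  from this[of 1] this[of \<i>] show ?thesis
    by (simp add: complex_eq_iff)
qed

lemma positive_square_sum:
  assumes "hermitian_inner_product_on V B" "f \<in> V" "u \<in> V" "v \<in> V" "f \<noteq> 0" "u \<noteq> 0" "v \<noteq> 0"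
  shows "B f f \<noteq> - B u u - B v v"
proof -
  have "Re (B w w) > 0" if "w \<in> V" "w \<noteq> 0" for w
    using hermitian_inner_product_onD(4)[OF assms(1) that] by (rule conjunct2)
  from this[of f] this[of u] this[of v] assms have "Re (B f f) > Re (- B u u - B v v)"
    by simp
  then show ?thesis by force
qed

text \<open>If \<open>f\<close> is the sum of \<open>K\<^sub>1 u\<close> and \<open>K\<^sub>2 v\<close>, and the negative adjoints \<open>P\<^sub>1\<close>, \<open>P\<^sub>2\<close> of \<open>K\<^sub>1\<close>, \<open>K\<^sub>2\<close>
  send \<open>f\<close> back to \<open>u\<close> and \<open>v\<close>, then \<open>f\<close> has square length minus the sum of those of \<open>u\<close> and \<open>v\<close>.\<close>

lemma not_unitary_raising:
  assumes V: "spinor_fun.subspace V" "V \<subseteq> spinor_poly"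
    and ne: "f \<noteq> 0" "u \<noteq> 0" "v \<noteq> 0"
    and mem: "f \<in> V" "u \<in> V" "v \<in> V"
    and Pf: "translation_action A f = u" "translation_action A' f = v"
    and Pu: "translation_action A u \<in> V" "translation_action A' v \<in> V"
    and Kf: "inverted_translation_action (ctranspose A) f \<in> V"
      "inverted_translation_action (ctranspose A') f \<in> V"
    and Ku: "inverted_translation_action (ctranspose A) u \<in> V"
      "inverted_translation_action (ctranspose A') v \<in> V"
    and f: "inverted_translation_action (ctranspose A) u
      + inverted_translation_action (ctranspose A') v = f"
  shows "\<not> u22_invariant_unitary_structure (lie_action pi_l) V B"
proof
  assume unitary: "u22_invariant_unitary_structure (lie_action pi_l) V B"
  then have inner: "hermitian_inner_product_on V B" by (simp add: u22_invariant_unitary_structure_def)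
  note add = hermitian_inner_product_onD(1)[OF inner] and herm = hermitian_inner_product_onD(3)[OF inner]
  let ?k = "inverted_translation_action (ctranspose A) u"
  let ?l = "inverted_translation_action (ctranspose A') v"
  have "B u u = - B f ?k" "B v v = - B f ?l"
    using translation_adjoint[OF unitary V, of f u A] translation_adjoint[OF unitary V, of f v A']
      mem Pf Pu Kf Ku by simp_all
  moreover have "B f ?k = cnj (B ?k f)" "B f ?l = cnj (B ?l f)"
    using herm[OF Ku(1) mem(1)] herm[OF Ku(2) mem(1)] by simp_all
  moreover have "B f f = B ?k f + B ?l f" using add[OF Ku mem(1)] f by simp
  moreover have "B f f = cnj (B f f)" using mem(1) mem(1) by (rule herm)
  ultimately have "B f f = - B u u - B v v" by (simp add: complex_eq_iff)
  with positive_square_sum[OF inner mem ne] show False by blast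
qed

text \<open>Here the images of \<open>u\<close> and \<open>v\<close> under translations are summed, and the inverted translations
  lead back.\<close>

lemma not_unitary_lowering:
  assumes V: "spinor_fun.subspace V" "V \<subseteq> spinor_poly"
    and ne: "f \<noteq> 0" "u \<noteq> 0" "v \<noteq> 0"
    and mem: "f \<in> V" "u \<in> V" "v \<in> V"
    and Kf: "inverted_translation_action (ctranspose A) f = u"
      "inverted_translation_action (ctranspose A') f = v"
    and Ku: "inverted_translation_action (ctranspose A) u \<in> V"
      "inverted_translation_action (ctranspose A') v \<in> V"
    and Pf: "translation_action A f \<in> V" "translation_action A' f \<in> V"
    and Pu: "translation_action A u \<in> V" "translation_action A' v \<in> V"
    and f: "translation_action A u + translation_action A' v = f"
  shows "\<not> u22_invariant_unitary_structure (lie_action pi_l) V B"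
proof
  assume unitary: "u22_invariant_unitary_structure (lie_action pi_l) V B"
  then have inner: "hermitian_inner_product_on V B" by (simp add: u22_invariant_unitary_structure_def)
  have "B (translation_action A u + translation_action A' v) f
      = B (translation_action A u) f + B (translation_action A' v) f"
    using Pu mem by (intro hermitian_inner_product_onD(1)[OF inner])
  moreover have "B (translation_action A u) f = - B u u" "B (translation_action A' v) f = - B v v"
    using translation_adjoint[OF unitary V, of u f A] translation_adjoint[OF unitary V, of v f A']
      mem Pf Pu Kf Ku by simp_all
  ultimately have "B f f = - B u u - B v v" using f by simp
  with positive_square_sum[OF inner mem ne] show False by blast
qed

section \<open>Explicit spinors\<close>

definition spinor :: "(HC \<Rightarrow> complex) \<Rightarrow> (HC \<Rightarrow> complex) \<Rightarrow> spinor_fun"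
  where "spinor \<phi> \<psi> = (\<lambda>Z. vector [\<phi> Z, \<psi> Z])"

lemma component_spinor [simp]: "component 1 (spinor \<phi> \<psi>) = \<phi>" "component 2 (spinor \<phi> \<psi>) = \<psi>"
  by (simp_all add: component_def spinor_def)

lemma spinor_nth [simp]: "spinor \<phi> \<psi> Z $ 1 = \<phi> Z" "spinor \<phi> \<psi> Z $ 2 = \<psi> Z"
  by (simp_all add: spinor_def)

lemma spinor_in: "\<phi> \<in> localized_poly \<Longrightarrow> \<psi> \<in> localized_poly \<Longrightarrow> spinor \<phi> \<psi> \<in> spinor_poly"
  by (simp add: spinor_poly_component forall_2)

lemma spinor_eqI:
  assumes "f \<in> spinor_poly \<or> (\<exists>g. f = on_units g)" "\<phi> \<in> localized_poly" "\<psi> \<in> localized_poly"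
    "\<And>Z. N Z \<noteq> 0 \<Longrightarrow> f Z $ 1 = \<phi> Z" "\<And>Z. N Z \<noteq> 0 \<Longrightarrow> f Z $ 2 = \<psi> Z"
  shows "f = spinor \<phi> \<psi>"
proof
  fix Z show "f Z = spinor \<phi> \<psi> Z"
  proof (cases "N Z = 0")
    case True
    have "component k f Z = 0" for k
      using assms(1) True localized_poly_off_units
      by (auto simp: spinor_poly_component, simp add: component_def)
    then show ?thesis using True assms(2,3)
      by (simp add: vec_eq_iff forall_2 localized_poly_off_units component_def)
  qed (use assms in \<open>simp add: vec_eq_iff forall_2\<close>)
qed

lemma translation_action_spinor:
  "translation_action A (spinor \<phi> \<psi>) = spinor (- D A \<phi>) (- D A \<psi>)"
proof
  fix Z show "translation_action A (spinor \<phi> \<psi>) Z = spinor (- D A \<phi>) (- D A \<psi>) Z"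
    by (cases "N Z = 0") (simp_all add: translation_action_def vec_eq_iff forall_2)
qed

lemma inverted_translation_action_eqI:
  assumes "\<phi> \<in> localized_poly" "\<psi> \<in> localized_poly"
    "\<And>Z. N Z \<noteq> 0 \<Longrightarrow> (Z ** C) $ 2 $ 2 * f Z $ 1 - (Z ** C) $ 1 $ 2 * f Z $ 2
      + D (Z ** C ** Z) (component 1 f) Z = \<phi> Z"
    "\<And>Z. N Z \<noteq> 0 \<Longrightarrow> (Z ** C) $ 1 $ 1 * f Z $ 2 - (Z ** C) $ 2 $ 1 * f Z $ 1
      + D (Z ** C ** Z) (component 2 f) Z = \<psi> Z"
  shows "inverted_translation_action C f = spinor \<phi> \<psi>"
  by (rule spinor_eqI)
    (use assms in \<open>auto simp: inverted_translation_action_def trace_def sum_2 matrix_vector_mult_def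
      algebra_simps\<close>)

text \<open>The defining equation has constant coefficients, so directional derivatives of solutions are
  solutions.\<close>

lemma translation_in_U_l:
  assumes "f \<in> U_l"
  shows "translation_action A f \<in> U_l"
proof -
  have f: "component k f \<in> localized_poly" for k
    using assms by (simp add: U_l_iff spinor_poly_component)
  have k: "component k (translation_action A f) = - D A (component k f)" for k
    by (auto simp: fun_eq_iff component_def translation_action_def on_units_def D_def)
  have "half_box (component k (translation_action A f)) = - D A (half_box (component k f))" for k
    unfolding k half_box_def using f by (simp add: D_commute[of _ _ A])
  then have "D E (half_box (component k (translation_action A f)))
      = - D A (D E (half_box (component k f)))" for k E
    using f by (simp add: D_commute[of _ E A])
  moreover have translated: "D A (D E (half_box (component 1 f))) Z + D A (D F (half_box (component 2 f))) Z = 0"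
    if "\<And>Z. N Z \<noteq> 0 \<Longrightarrow> D E (half_box (component 1 f)) Z + D F (half_box (component 2 f)) Z = 0"
    for E F Z
  proof -
    have "D E (half_box (component 1 f)) + D F (half_box (component 2 f)) = 0"
      by (rule localized_poly_eqI) (use f that in simp_all)
    then have "D A (D E (half_box (component 1 f)) + D F (half_box (component 2 f))) Z = 0" by simp
    then show ?thesis using f by simp
  qed
  moreover have "translation_action A f \<in> spinor_poly"
    using f by (simp add: spinor_poly_component k)
  ultimately show ?thesis
    using assms translated[of "matrix_unit 1 1" "matrix_unit 2 1"]
      translated[of "matrix_unit 1 2" "matrix_unit 2 2"]
    unfolding U_l_iff by (simp add: neg_eq_iff_add_eq_0)
qed

text \<open>With names for the entries and for \<open>1 / N(Z)\<close>, the identities below lie in the ideal generated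
  by the single relation \<open>n (a d - b c) = 1\<close>.\<close>

lemma entry_variables:
  fixes Z :: HC
  assumes "N Z \<noteq> 0"
  obtains a b c d n where "Z $ 1 $ 1 = a" "Z $ 1 $ 2 = b" "Z $ 2 $ 1 = c" "Z $ 2 $ 2 = d"
    "Ninv Z = n" "n * (a * d - b * c) = 1"
  using assms by (simp flip: det_2)

lemma half_box_Ninv: "half_box Ninv = 0"
proof (rule localized_poly_eqI)
  fix Z :: HC assume Z: "N Z \<noteq> 0"
  then obtain a b c d n where z: "Z $ 1 $ 1 = a" "Z $ 1 $ 2 = b" "Z $ 2 $ 1 = c" "Z $ 2 $ 2 = d"
    "Ninv Z = n" and n: "n * (a * d - b * c) = 1" by (rule entry_variables)
  show "half_box Ninv Z = 0 Z"
    by (simp add: Z z half_box_def polarN_def del: Ninv_eval) (use n in algebra)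
qed simp_all

lemma half_box_entry_Ninv:
  "half_box (entry i j * Ninv) = cst (-2) * (entry i j * (Ninv * Ninv))"
proof (rule localized_poly_eqI)
  fix Z :: HC assume Z: "N Z \<noteq> 0"
  then obtain a b c d n where z: "Z $ 1 $ 1 = a" "Z $ 1 $ 2 = b" "Z $ 2 $ 1 = c" "Z $ 2 $ 2 = d"
    "Ninv Z = n" and n: "n * (a * d - b * c) = 1" by (rule entry_variables)
  have "\<forall>i j. half_box (entry i j * Ninv) Z = (cst (-2) * (entry i j * (Ninv * Ninv))) Z"
    unfolding forall_2
    by (intro conjI; simp add: Z z half_box_def polarN_def del: Ninv_eval; use n in algebra)
  then show "half_box (entry i j * Ninv) Z = (cst (-2) * (entry i j * (Ninv * Ninv))) Z" by blast
qed simp_all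

text \<open>By the preceding lemma \<open>\<box>\<close> turns the columns of \<open>Z / N(Z)\<close> into multiples of those of
  \<open>Z / N(Z)\<^sup>2\<close>, and these are annihilated by \<open>\<nabla>\<close>.\<close>

lemma column_in_U_l: "spinor (entry 1 j * Ninv) (entry 2 j * Ninv) \<in> U_l"
proof -
  have "D (matrix_unit 1 k) (half_box (entry 1 j * Ninv)) Z
      + D (matrix_unit 2 k) (half_box (entry 2 j * Ninv)) Z = 0" if Z: "N Z \<noteq> 0" for k Z
  proof -
    from Z obtain a b c d n where z: "Z $ 1 $ 1 = a" "Z $ 1 $ 2 = b" "Z $ 2 $ 1 = c" "Z $ 2 $ 2 = d"
      "Ninv Z = n" and n: "n * (a * d - b * c) = 1" by (rule entry_variables)
    have "\<forall>j k. D (matrix_unit 1 k) (half_box (entry 1 j * Ninv)) Z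
        + D (matrix_unit 2 k) (half_box (entry 2 j * Ninv)) Z = 0"
      unfolding half_box_entry_Ninv forall_2
      by (intro conjI; simp add: Z z polarN_def del: Ninv_eval; use n in algebra)
    then show ?thesis by blast
  qed
  then show ?thesis by (simp add: U_l_iff spinor_in)
qed

lemma N_mscale [simp]: "N (mscale c Z) = c\<^sup>2 * N Z"
  by (simp add: det_2 mscale_def power2_eq_square algebra_simps)

lemma spinor_nonzero: "\<phi> Z \<noteq> 0 \<or> \<psi> Z \<noteq> 0 \<Longrightarrow> spinor \<phi> \<psi> \<noteq> 0"
  by (metis spinor_nth zero_fun_apply zero_index)

lemma spinor_in_U_l:
  assumes "spinor \<phi> \<psi> \<in> U_l"
    "\<And>c Z. c \<noteq> 0 \<Longrightarrow> N Z \<noteq> 0 \<Longrightarrow> \<phi> (mscale c Z) = c powi d * \<phi> Z"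
    "\<And>c Z. c \<noteq> 0 \<Longrightarrow> N Z \<noteq> 0 \<Longrightarrow> \<psi> (mscale c Z) = c powi d * \<psi> Z"
  shows spinor_in_U_l_plus: "d \<ge> 0 \<Longrightarrow> spinor \<phi> \<psi> \<in> U_l_plus"
    and spinor_in_U_l_minus: "d < 0 \<Longrightarrow> spinor \<phi> \<psi> \<in> U_l_minus"
proof -
  have "homogeneous d (spinor \<phi> \<psi>)"
    using assms(2,3) by (simp add: homogeneous_def vec_eq_iff forall_2)
  with assms(1) show "d \<ge> 0 \<Longrightarrow> spinor \<phi> \<psi> \<in> U_l_plus" "d < 0 \<Longrightarrow> spinor \<phi> \<psi> \<in> U_l_minus"
    unfolding U_l_plus_def U_l_minus_def by (blast intro: spinor_fun.span_base)+
qed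

text \<open>Here \<open>f\<close> is the second column of \<open>Z\<close>. The translations by \<open>?A\<close> and \<open>?A'\<close> differentiate it in
  the directions of its two entries, which gives the two constant basis spinors.\<close>

lemma not_unitary_U_l_plus:
  "\<not> u22_invariant_unitary_structure (lie_action pi_l) U_l_plus B"
proof (rule not_unitary_raising)
  let ?A = "- matrix_unit 1 2" and ?A' = "- matrix_unit 2 2"
  let ?u = "spinor (cst 1) 0" and ?v = "spinor 0 (cst 1)" and ?f = "spinor (entry 1 2) (entry 2 2)"
  let ?K = "inverted_translation_action (ctranspose ?A)"
  let ?K' = "inverted_translation_action (ctranspose ?A')"
  have C: "ctranspose ?A = - matrix_unit 2 1" "ctranspose ?A' = - matrix_unit 2 2"
    by (simp_all add: ctranspose_def vec_eq_iff)
  note K = inverted_translation_action_eqI and entries = matrix_matrix_mult_def sum_2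
  have K_u: "?K ?u = spinor 0 (entry 2 2)" and K_v: "?K' ?v = spinor (entry 1 2) 0"
    unfolding C by (rule K; simp add: entries)+
  have K_f: "?K ?f = spinor (- (entry 1 2 * entry 1 2)) (- (entry 1 2 * entry 2 2))"
    "?K' ?f = spinor (- (entry 2 2 * entry 1 2)) (- (entry 2 2 * entry 2 2))"
    unfolding C by (rule K; simp add: entries algebra_simps)+
  show P_f: "translation_action ?A ?f = ?u" "translation_action ?A' ?f = ?v"
    unfolding translation_action_spinor
    by (intro spinor_eqI; simp add: spinor_in)+
  have P_u: "translation_action ?A ?u = 0" "translation_action ?A' ?v = 0"
    unfolding translation_action_spinor by (auto simp: fun_eq_iff vec_eq_iff forall_2)
  show "?K ?u + ?K' ?v = ?f"
    unfolding K_u K_v by (auto simp: fun_eq_iff vec_eq_iff forall_2)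
  show "?u \<in> U_l_plus" "?v \<in> U_l_plus"
    by (rule spinor_in_U_l_plus[where d = 0]; simp add: U_l_iff spinor_in half_box_def)+
  show "?f \<in> U_l_plus" "?K ?u \<in> U_l_plus" "?K' ?v \<in> U_l_plus"
    unfolding K_u K_v by (rule spinor_in_U_l_plus[where d = 1]; simp add: U_l_iff spinor_in half_box_def)+
  show "?K ?f \<in> U_l_plus" "?K' ?f \<in> U_l_plus"
    unfolding K_f
    by (rule spinor_in_U_l_plus[where d = 2]; simp add: U_l_iff spinor_in half_box_def power2_eq_square)+
  show "spinor_fun.subspace U_l_plus" by (simp add: U_l_plus_def spinor_fun.subspace_span)
  then show "translation_action ?A ?u \<in> U_l_plus" "translation_action ?A' ?v \<in> U_l_plus"
    unfolding P_u by (rule spinor_fun.subspace_0)+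
  show "?f \<noteq> 0" "?u \<noteq> 0" "?v \<noteq> 0"
    by (rule spinor_nonzero[of _ "mat 1"]; simp)+
qed (rule U_l_plus_spinor_poly)

text \<open>The inverted translations take \<open>f\<close>, the second basis spinor divided by \<open>N(Z)\<close>, to the two columns
  of \<open>Z / N(Z)\<close>, which they annihilate. Translating them
  back produces two fractions over \<open>N(Z)\<^sup>2\<close> that add up to \<open>f\<close>, because
  \<open>a d - b c = N(Z)\<close>.\<close>

lemma not_unitary_U_l_minus:
  "\<not> u22_invariant_unitary_structure (lie_action pi_l) U_l_minus B"
proof (rule not_unitary_lowering)
  let ?A = "- matrix_unit 2 1" and ?A' = "- matrix_unit 2 2"
  let ?u = "spinor (entry 1 1 * Ninv) (entry 2 1 * Ninv)"
  let ?v = "spinor (entry 1 2 * Ninv) (entry 2 2 * Ninv)" and ?f = "spinor 0 Ninv"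
  let ?K = "inverted_translation_action (ctranspose ?A)"
  let ?K' = "inverted_translation_action (ctranspose ?A')"
  have C: "ctranspose ?A = - matrix_unit 1 2" "ctranspose ?A' = - matrix_unit 2 2"
    by (simp_all add: ctranspose_def vec_eq_iff)
  note K = inverted_translation_action_eqI and entries = matrix_matrix_mult_def sum_2
  show K_f: "?K ?f = ?u" "?K' ?f = ?v"
    unfolding C by (rule K; simp add: entries polarN_def; simp add: field_simps; simp add: det_2 algebra_simps)+
  have K_u: "?K ?u = spinor 0 0" "?K' ?v = spinor 0 0"
    unfolding C by (rule K; simp add: entries polarN_def; simp add: field_simps; simp add: det_2 algebra_simps)+
  have P_u: "translation_action ?A ?u
      = spinor (entry 1 1 * entry 1 2 * (Ninv * Ninv)) (entry 1 1 * entry 2 2 * (Ninv * Ninv))"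
    and P_v: "translation_action ?A' ?v
      = spinor (- (entry 1 1 * entry 1 2 * (Ninv * Ninv))) (- (entry 1 2 * entry 2 1 * (Ninv * Ninv)))"
    unfolding translation_action_spinor
    by (intro spinor_eqI; simp add: spinor_in polarN_def; simp add: field_simps; simp add: det_2 algebra_simps)+
  have P_f: "translation_action ?A ?f = spinor 0 (entry 1 2 * (Ninv * Ninv))"
    "translation_action ?A' ?f = spinor 0 (- (entry 1 1 * (Ninv * Ninv)))"
    unfolding translation_action_spinor
    by (intro spinor_eqI; simp add: spinor_in polarN_def)+
  show "translation_action ?A ?u + translation_action ?A' ?v = ?f"
    unfolding P_u P_v
    by (intro spinor_eqI; simp add: spinor_in spinor_fun.subspace_add[OF spinor_poly_subspace]; simp add: field_simps; simp add: det_2 algebra_simps)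
  have f: "?f \<in> U_l" by (simp add: U_l_iff spinor_in half_box_Ninv)
  have uv: "?u \<in> U_l" "?v \<in> U_l" by (rule column_in_U_l)+
  note hom = field_simps power_int_minus power2_eq_square power3_eq_cube
  show "?f \<in> U_l_minus"
    using f by (rule spinor_in_U_l_minus[where d = "-2"]; simp add: hom)
  show "?u \<in> U_l_minus"
    using uv(1) by (rule spinor_in_U_l_minus[where d = "-1"]; simp add: hom)
  show "?v \<in> U_l_minus"
    using uv(2) by (rule spinor_in_U_l_minus[where d = "-1"]; simp add: hom)
  show "translation_action ?A ?u \<in> U_l_minus"
    using translation_in_U_l[OF uv(1), of ?A] unfolding P_u
    by (rule spinor_in_U_l_minus[where d = "-2"]; simp add: hom)
  show "translation_action ?A' ?v \<in> U_l_minus"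
    using translation_in_U_l[OF uv(2), of ?A'] unfolding P_v
    by (rule spinor_in_U_l_minus[where d = "-2"]; simp add: hom)
  show "translation_action ?A ?f \<in> U_l_minus"
    using translation_in_U_l[OF f, of ?A] unfolding P_f
    by (rule spinor_in_U_l_minus[where d = "-3"]; simp add: hom)
  show "translation_action ?A' ?f \<in> U_l_minus"
    using translation_in_U_l[OF f, of ?A'] unfolding P_f
    by (rule spinor_in_U_l_minus[where d = "-3"]; simp add: hom)
  show sub: "spinor_fun.subspace U_l_minus" by (simp add: U_l_minus_def spinor_fun.subspace_span)
  have "spinor 0 0 = 0" by (auto simp: fun_eq_iff vec_eq_iff forall_2)
  then show "?K ?u \<in> U_l_minus" "?K' ?v \<in> U_l_minus"
    unfolding K_u using spinor_fun.subspace_0[OF sub] by simp_all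
  show "?f \<noteq> 0" by (rule spinor_nonzero[of _ "mat 1"]; simp)
  show "?u \<noteq> 0" "?v \<noteq> 0"
    by (rule spinor_nonzero[of _ "mat 1"]; simp)+
qed (rule U_l_minus_spinor_poly)

theorem corollary50:
  shows "\<not> (\<exists>B. u22_invariant_unitary_structure (lie_action pi_l) U_l_plus B) \<and>
         \<not> (\<exists>B. u22_invariant_unitary_structure (lie_action pi_l) U_l_minus B) \<and>
         \<not> (\<exists>B. u22_invariant_unitary_structure (lie_action pi_r) U_r_plus B) \<and>
         \<not> (\<exists>B. u22_invariant_unitary_structure (lie_action pi_r) U_r_minus B)"
  using not_unitary_U_l_plus not_unitary_U_l_minus
    unitary_structure_transposed[OF _ U_l_plus_spinor_poly transposed_in_U_r_plus]
    unitary_structure_transposed[OF _ U_l_minus_spinor_poly transposed_in_U_r_minus]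
  by blast

end
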